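(* Let $n\ge 2$ and $k\ge 1$ be integers. Then \[ E_{\mathrm{Car}_{n+1}}(k)=\frac{1}{kn+n-3}\binom{kn+2n-5}{n-1}\binom{n+k-3}{k-1}. \]
   Context: All directed graphs are connected, have integer vertices, and every directed edge has the form $(i,j)$ with $i<j$; multiple edges are allowed (each copy counts as a separate edge), loops are not. Flow polytope: let $G$ be such a graph with $N+1$ vertices $v_1<v_2<\dots<v_{N+1}$ and $M$ edges, with edge multiset $E$, and let $\mathbf a=(a_1,\dots,a_N)\in\mathbb Z^N$. The flow polytope $\mathcal F_G(\mathbf a)$ is the set of all $(b_e)_{e\in E}\in\mathbb R_{\ge0}^M$ such that $\sum_{e=(v_i,v_j)\in E} b_e(\mathbf e_i-\mathbf e_j)=(a_1,\dots,a_N,-\sum_{i=1}^N a_i)$, where $\mathbf e_i$ is the $i$th standard basis vector of $\mathbb R^{N+1}$. Its normalized volume $\operatorname{vol}\mathcal F_G(\mathbf a)$ is $(M-N)!$ times its $(M-N)$-dimensional volume in the affine space cut out by these equations, where the volume is scaled so that a fundamental parallelepiped of the lattice $\{b\in\mathbb Z^M:\sum b_e(\mathbf e_i-\mathbf e_j)=0\}$ has volume $1$. The caracol graph $\mathrm{Car}_{n+1}$ has vertex set $\{1,\dots,n+1\}$ and edge set $\{(i,i+1): 1\le i\le n\}\cup\{(1,i): 3\le i\le n\}\cup\{(i,n+1): 2\le i\le n-1\}$. For a positive integer $k$ and a directed graph $G$ on $\{1,\dots,n+1\}$, let $\widehat G(k)$ be the directed graph obtained from $G$ by adding a new vertex $0$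 and $k$ parallel edges $(0,i)$ for each $1\le i\le n+1$. Define $E_G(k)=\operatorname{vol}\mathcal F_{\widehat G(k)}(1,0^n)$, where $(1,0^n)$ is the net flow vector with entry $1$ at vertex $0$ and entry $0$ at vertices $1,\dots,n$. *)

theory Defs
  imports "HOL-Analysis.Analysis" "Graph_Theory.Digraph"
begin

text \<open>
  Directed multigraphs are \<^typ>\<open>('a, 'b) pre_digraph\<close> records: parallel edges are distinct elements
  of \<open>arcs\<close>. All graphs considered are finite, connected and have \<open>tail G e < head G e\<close> for
  every arc \<open>e\<close>. A vector in \<open>\<real>\<^sup>E\<close> is a real function on the arc type that
  vanishes outside \<open>arcs G\<close>.
\<close>

definition edge_vectors :: "('a, 'b) pre_digraph \<Rightarrow> ('b \<Rightarrow> real) set" where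
  "edge_vectors G = {b. \<forall>e. e \<notin> arcs G \<longrightarrow> b e = 0}"

text \<open>The coordinate at \<open>v\<close> of the sum over all edges \<open>e = (v\<^sub>i, v\<^sub>j)\<close> of
  \<open>b\<^sub>e (e\<^sub>i - e\<^sub>j)\<close>.\<close>
definition net_flow :: "('a, 'b) pre_digraph \<Rightarrow> ('b \<Rightarrow> real) \<Rightarrow> 'a \<Rightarrow> real" where
  "net_flow G b v = (\<Sum>e\<in>out_arcs G v. b e) - (\<Sum>e\<in>in_arcs G v. b e)"

text \<open>The vector \<open>(a\<^sub>1, \<dots>, a\<^sub>N, - (a\<^sub>1 + \<dots> + a\<^sub>N))\<close> indexed by the vertices in increasing order;
  the value of \<open>a\<close> at the largest vertex is irrelevant.\<close>
definition full_net_flow :: "('a::linorder, 'b) pre_digraph \<Rightarrow> ('a \<Rightarrow> int) \<Rightarrow> 'a \<Rightarrow> int" where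
  "full_net_flow G a v =
     (if v = Max (verts G) then - (\<Sum>w\<in>verts G - {Max (verts G)}. a w) else a v)"

definition flow_space :: "('a::linorder, 'b) pre_digraph \<Rightarrow> ('a \<Rightarrow> int) \<Rightarrow> ('b \<Rightarrow> real) set" where
  "flow_space G a =
     {b \<in> edge_vectors G. \<forall>v\<in>verts G. net_flow G b v = of_int (full_net_flow G a v)}"

definition flow_polytope :: "('a::linorder, 'b) pre_digraph \<Rightarrow> ('a \<Rightarrow> int) \<Rightarrow> ('b \<Rightarrow> real) set" where
  "flow_polytope G a = {b \<in> flow_space G a. \<forall>e\<in>arcs G. 0 \<le> b e}"

definition flow_lattice :: "('a, 'b) pre_digraph \<Rightarrow> ('b \<Rightarrow> real) set" where
  "flow_lattice G =
     {b \<in> edge_vectors G. (\<forall>e. b e \<in> \<int>) \<and> (\<forall>v\<in>verts G. net_flow G b v = 0)}"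

text \<open>\<open>M - N\<close>, for \<open>M\<close> edges and \<open>N + 1\<close> vertices.\<close>
definition flow_dim :: "('a, 'b) pre_digraph \<Rightarrow> nat" where
  "flow_dim G = card (arcs G) - (card (verts G) - 1)"

text \<open>\<open>u 0, \<dots>, u (d - 1)\<close> is a \<open>\<int>\<close>-basis of the lattice \<open>L\<close>.\<close>
definition lattice_basis :: "nat \<Rightarrow> (nat \<Rightarrow> 'b \<Rightarrow> real) \<Rightarrow> ('b \<Rightarrow> real) set \<Rightarrow> bool" where
  "lattice_basis d u L \<longleftrightarrow>
     bij_betw (\<lambda>(c :: nat \<Rightarrow> int) e. \<Sum>i<d. of_int (c i) * u i e) ({..<d} \<rightarrow>\<^sub>E UNIV) L"

text \<open>The \<open>d\<close>-dimensional volume of \<open>P\<close> inside the affine space through \<open>x\<close> spanned by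
  \<open>u 0, \<dots>, u (d - 1)\<close>, scaled so that the parallelepiped with these edges has volume 1: the
  Lebesgue measure of \<open>P\<close> in the coordinates \<open>c \<mapsto> x + \<Sum>i<d. c i * u i\<close>.\<close>
definition relative_volume ::
    "nat \<Rightarrow> (nat \<Rightarrow> 'b \<Rightarrow> real) \<Rightarrow> ('b \<Rightarrow> real) \<Rightarrow> ('b \<Rightarrow> real) set \<Rightarrow> real" where
  "relative_volume d u x P =
     measure (\<Pi>\<^sub>M i\<in>{..<d}. lborel)
       {c \<in> {..<d} \<rightarrow>\<^sub>E UNIV. (\<lambda>e. x e + (\<Sum>i<d. c i * u i e)) \<in> P}"

text \<open>The choice of the lattice basis and of the base point does not matter: two lattice bases
  differ by a unimodular integer matrix, and a change of base point is a translation. A lattice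
  basis with \<open>flow_dim G\<close> elements exists because \<open>G\<close> is connected.\<close>
definition flow_polytope_vol :: "('a::linorder, 'b) pre_digraph \<Rightarrow> ('a \<Rightarrow> int) \<Rightarrow> real" where
  "flow_polytope_vol G a =
     fact (flow_dim G) *
     relative_volume (flow_dim G)
       (SOME u. lattice_basis (flow_dim G) u (flow_lattice G))
       (SOME x. x \<in> flow_space G a)
       (flow_polytope G a)"

text \<open>\<open>caracol n\<close> is the caracol graph on the \<open>n + 1\<close> vertices \<open>1, \<dots>, n + 1\<close>.\<close>
definition caracol :: "nat \<Rightarrow> (nat, nat \<times> nat) pre_digraph" where
  "caracol n =
     \<lparr>verts = {1..n + 1},
      arcs = {(i, i + 1) | i. 1 \<le> i \<and> i \<le> n}
           \<union> {(1, i) | i. 3 \<le> i \<and> i \<le> n}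
           \<union> {(i, n + 1) | i. 2 \<le> i \<and> i \<le> n - 1},
      tail = fst, head = snd\<rparr>"

text \<open>The graph \<open>G\<close> on \<open>{1..n + 1}\<close> with an additional vertex \<open>0\<close> and \<open>k\<close> parallel edges from
  \<open>0\<close> to each vertex of \<open>G\<close>; \<open>Inr (i, j)\<close> is the \<open>j\<close>-th copy of the edge \<open>(0, i)\<close>.\<close>
definition hat_graph :: "(nat, 'b) pre_digraph \<Rightarrow> nat \<Rightarrow> (nat, 'b + nat \<times> nat) pre_digraph" where
  "hat_graph G k =
     \<lparr>verts = insert 0 (verts G),
      arcs = Inl ` arcs G \<union> Inr ` (verts G \<times> {..<k}),
      tail = case_sum (tail G) (\<lambda>_. 0),
      head = case_sum (head G) fst\<rparr>"

definition E_poly :: "(nat, 'b) pre_digraph \<Rightarrow> nat \<Rightarrow> real" where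
  "E_poly G k = flow_polytope_vol (hat_graph G k) (\<lambda>v. if v = 0 then 1 else 0)"

end

theory Submission
  imports Defs "HOL-Probability.Probability" "HOL-Computational_Algebra.Formal_Power_Series"
begin

text \<open>
  In coordinates given by a basis of the flow lattice, the polytope is a cone \<open>C\<close> cut off by
  \<open>\<tau> \<le> 1\<close>, where \<open>\<tau>\<close> is linear; hence its normalized volume is the integral of \<open>exp (- \<tau>)\<close> over
  \<open>C\<close>. This integral is evaluated one edge at a time. If the vertices of the caracol graph are
  processed in increasing order, the integrand at each stage is a polynomial in two quantities: the flow \<open>s\<close>
  entering the next vertex along the spine, and the flow \<open>p\<close> that vertex 1 still has to
  distribute. Integrating over one edge acts on the monomials \<open>s\<^sup>a/a! \<cdot> p\<^sup>b/b!\<close> by a simple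
  shift rule, so that the integral becomes a weighted count of excursions with up-steps of height
  1, which the cycle lemma evaluates as the coefficient of \<open>x\<^sup>n\<^sup>-\<^sup>2\<close> in
  \<open>h\<^sup>n\<^sup>-\<^sup>1/(n - 1)\<close> with \<open>h = 1/((1 - t x)(1 - x)\<^sup>k)\<close>,
  where \<open>t\<close> keeps track of the exponent \<open>b\<close>.
\<close>

section \<open>Weighted excursions\<close>

text \<open>One copy of the arc from the source to the last vertex, \<open>sink_arc\<close>, serves
  as slack: its flow is 1 - \<tau>, where \<tau> is the total flow on all other source arcs. So
  \<tau> \<le> 1 is the only inhomogeneous constraint, and exp(-\<tau>) factors over source arcs,
  leaving plain interval constraints on the others. The iterated integral is evaluated from the
  inside, hence from the last vertex back: starting from the constant 1, a spine arc raises the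
  exponent a by 1, the other arcs of a block may lower it, and evaluation at the empty state (0, 0)
  keeps only a = 0. The arcs into vertex 1 leave the factor (k-1+b) choose b, which is not
  exponential in b; it becomes so as the coefficient of u^(k-1) in t^(b+1) with t = 1/(1-u). This is
  why the excursions are counted over a ring of series in u. The volume is defined through an
  arbitrarily chosen lattice basis, so invariance under unimodular changes of coordinates has to be
  proved; this is done by tiling with integer translates, without determinants.\<close>

definition geom :: "'a::comm_ring_1 \<Rightarrow> 'a fps" where
  "geom t = Abs_fps (\<lambda>c. t ^ c)"

lemma geom_nth [simp]: "fps_nth (geom t) c = t ^ c"
  by (simp add: geom_def)

text \<open>The negative binomial series of (1 - t x)^(-m-1); the induction step is the hockey-stick
  summation.\<close>

lemma geom_power_nth: "fps_nth (geom t ^ Suc m) c = of_nat ((c + m) choose m) * t ^ c"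
proof (induction m arbitrary: c)
  case 0
  then show ?case by simp
next
  case (Suc m)
  have "fps_nth (geom t ^ Suc (Suc m)) c = (\<Sum>i=0..c. fps_nth (geom t ^ Suc m) i * t ^ (c - i))"
    by (subst power_Suc2, subst fps_mult_nth) simp
  also have "\<dots> = (\<Sum>i=0..c. of_nat ((i + m) choose m) * t ^ c)"
    by (intro sum.cong refl)
       (simp only: Suc.IH mult.assoc power_add[symmetric] atLeastAtMost_iff le_add_diff_inverse)
  also have "\<dots> = of_nat (\<Sum>i\<le>c. ((m + i) choose m)) * t ^ c"
    by (simp add: sum_distrib_right atLeast0AtMost add.commute)
  also have "(\<Sum>i\<le>c. ((m + i) choose m)) = (\<Sum>i\<le>c. ((m + i) choose i))"
    by (intro sum.cong refl) (metis add_diff_cancel_left' binomial_symmetric le_add1)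
  also have "\<dots> = Suc (m + c) choose c"
    by (rule sum_choose_lower)
  also have "\<dots> = (c + Suc m) choose (Suc m)"
    by (subst binomial_symmetric) (simp_all add: add.commute)
  finally show ?case .
qed

lemma geom_1_power_nth: "k \<ge> 1 \<Longrightarrow> fps_nth (geom 1 ^ k) c = of_nat ((c + k - 1) choose (k - 1))"
  using geom_power_nth[of 1 "k - 1" c] by simp

text \<open>The coefficient at a is the sum of h_c A_(a+1-c): go up from height a by 1, then down by
  c with weight h_c, and continue with the weights A. Iterating on 1 and reading off the coefficient
  at 0 therefore counts excursions.\<close>

definition excursion_step :: "'a::comm_ring_1 fps \<Rightarrow> 'a fps \<Rightarrow> 'a fps" where
  "excursion_step h A = fps_shift 1 (h * A)"

text \<open>Lagrange inversion for the paths of the cycle lemma, in the form of an identity that is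
  invariant under moving one step from \<open>r\<close> to \<open>j\<close>.\<close>

lemma excursion_step_invariant:
  fixes h :: "'a::comm_ring_1 fps"
  shows "of_nat (Suc j) * fps_nth (h ^ Suc (Suc j) * fps_deriv (fps_X * A)) (Suc j) =
         of_nat (Suc (Suc j)) * fps_nth (h ^ Suc j * fps_deriv (fps_X * excursion_step h A)) j"
proof -
  define P where "P = h ^ Suc (Suc j)"
  \<comment> \<open>After multiplication by x the shift loses only a constant, which the derivative
    removes. What remains is the product rule for P A.\<close>
  have "fps_X * excursion_step h A = h * A - fps_const (fps_nth (h * A) 0)"
    by (rule fps_ext) (auto simp: excursion_step_def)
  then have "fps_deriv (fps_X * excursion_step h A) = fps_deriv (h * A)"
    by simp
  moreover have "fps_deriv P = of_nat (Suc (Suc j)) * (h ^ Suc j * fps_deriv h)"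
    by (simp only: P_def fps_deriv_power diff_Suc_1 fps_of_nat mult_ac)
  moreover have "P = h * h ^ Suc j"
    by (simp add: P_def)
  ultimately have "of_nat (Suc (Suc j)) * (h ^ Suc j * fps_deriv (fps_X * excursion_step h A)) =
      fps_deriv (P * A) + of_nat (Suc j) * (P * fps_deriv A)"
    by (simp add: algebra_simps)
  then have "of_nat (Suc (Suc j)) * fps_nth (h ^ Suc j * fps_deriv (fps_X * excursion_step h A)) j =
      fps_nth (fps_deriv (P * A)) j + of_nat (Suc j) * fps_nth (P * fps_deriv A) j"
    by (metis fps_add_nth fps_mult_of_nat_nth(1))
  also have "\<dots> = of_nat (Suc j) * fps_nth (P * A + fps_X * (P * fps_deriv A)) (Suc j)"
    by (simp add: algebra_simps del: fps_deriv_mult)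
  also have "P * A + fps_X * (P * fps_deriv A) = P * fps_deriv (fps_X * A)"
    by (simp add: algebra_simps)
  finally show ?thesis
    by (simp add: P_def)
qed

text \<open>The induction needs an arbitrary series A in place of 1, with right-hand side the
  coefficient of x^j in h^(j+1) (x A)'. At A = 1 the derivative is 1.\<close>

lemma excursion_count:
  fixes h :: "'a::{idom,semiring_char_0} fps"
  assumes "fps_nth h 0 = 1"
  shows "of_nat (Suc r) * fps_nth ((excursion_step h ^^ r) 1) 0 = fps_nth (h ^ Suc r) r"
proof -
  have "of_nat (Suc j) * fps_nth ((excursion_step h ^^ j) A) 0 =
      fps_nth (h ^ Suc j * fps_deriv (fps_X * A)) j" for j and A :: "'a fps"
  proof (induction j arbitrary: A)
    case 0
    then show ?case using assms by simp
  next
    case (Suc j)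
    have "of_nat (Suc j) * (of_nat (Suc (Suc j)) * fps_nth ((excursion_step h ^^ Suc j) A) 0) =
        of_nat (Suc (Suc j)) * fps_nth (h ^ Suc j * fps_deriv (fps_X * excursion_step h A)) j"
      using Suc.IH[of "excursion_step h A"]
      by (simp add: funpow_Suc_right mult.left_commute del: funpow.simps of_nat_Suc)
    also have "\<dots> = of_nat (Suc j) * fps_nth (h ^ Suc (Suc j) * fps_deriv (fps_X * A)) (Suc j)"
      by (rule excursion_step_invariant[symmetric])
    finally show ?case
      by (simp del: of_nat_Suc)
  qed
  from this[of r 1] show ?thesis by simp
qed

text \<open>Both sides are the trinomial (B+r+k-1)! / (B! r! (k-1)!). On the right only one factor
  depends on B, which turns the later sum over B into a convolution.\<close>

lemma choose_mult_choose:
  assumes "k \<ge> 1"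
  shows "((B + r) choose r) * ((B + r + k - 1) choose (k - 1)) =
    ((r + k - 1) choose (k - 1)) * ((B + (r + k) - 1) choose (r + k - 1))"
proof -
  have "((B + r + k - 1) choose (B + r)) * ((B + r) choose B) =
      ((B + r + k - 1) choose B) * ((B + r + k - 1 - B) choose (B + r - B))"
    using assms by (intro choose_mult) auto
  moreover have "(B + r + k - 1) choose (B + r) = (B + r + k - 1) choose (k - 1)"
    using assms by (subst binomial_symmetric) auto
  moreover have "(B + r) choose B = (B + r) choose r"
    by (subst binomial_symmetric) auto
  moreover have "(B + r + k - 1) choose B = (B + (r + k) - 1) choose (r + k - 1)"
    using assms by (subst binomial_symmetric) (auto simp: algebra_simps)
  moreover have "(B + r + k - 1 - B) choose (B + r - B) = (r + k - 1) choose (k - 1)"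
    using assms by (subst binomial_symmetric) auto
  ultimately show ?thesis
    by (simp add: mult.commute)
qed

text \<open>The series h of the overview with t = 1/(1-u): the inner \<open>geom 1\<close> is a
  series in u, the two outer factors are series in x.\<close>

definition block_series :: "nat \<Rightarrow> real fps fps" where
  "block_series k = geom (geom 1) * geom 1 ^ k"

text \<open>The prefactor \<open>geom 1 ^ Suc r\<close> collects one t from each of the r blocks and
  the t of t^(b+1) at b = 0.\<close>

lemma caracol_excursions:
  assumes "k \<ge> 1"
  shows "real (Suc r) * fps_nth (geom 1 ^ Suc r * fps_nth ((excursion_step (block_series k) ^^ r) 1) 0) (k - 1) =
    real ((r + k - 1) choose (k - 1)) * real ((k * (r + 2) + 2 * r - 1) choose r)"
proof -
  define h where "h = block_series k"
  define \<tau> :: "real fps" where "\<tau> = geom 1"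
  define q where "q = k * Suc r"
  have q: "q \<ge> 1"
    using assms by (simp add: q_def)
  have h_power: "h ^ Suc r = geom \<tau> ^ Suc r * geom 1 ^ q"
    by (simp only: h_def block_series_def \<tau>_def q_def power_mult_distrib power_mult)
  have "fps_nth h 0 = 1"
    by (simp add: h_def block_series_def fps_mult_nth_0 fps_power_zeroth)
  then have "of_nat (Suc r) * fps_nth ((excursion_step h ^^ r) 1) 0 = fps_nth (h ^ Suc r) r"
    by (rule excursion_count)
  also have "\<dots> = (\<Sum>B=0..r. (of_nat ((B + r) choose r) * \<tau> ^ B) * of_nat ((r - B + q - 1) choose (q - 1)))"
    unfolding h_power fps_mult_nth by (intro sum.cong refl) (simp only: geom_power_nth geom_1_power_nth[OF q])
  finally have "of_nat (Suc r) * (\<tau> ^ Suc r * fps_nth ((excursion_step h ^^ r) 1) 0) =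
      (\<Sum>B=0..r. of_nat ((B + r) choose r) * of_nat ((r - B + q - 1) choose (q - 1)) * \<tau> ^ (B + Suc r))"
    by (simp only: mult.left_commute[of "of_nat (Suc r)"]) (simp add: sum_distrib_left power_add mult_ac)
  then have "real (Suc r) * fps_nth (\<tau> ^ Suc r * fps_nth ((excursion_step h ^^ r) 1) 0) (k - 1) =
      fps_nth (\<Sum>B=0..r. of_nat ((B + r) choose r) * of_nat ((r - B + q - 1) choose (q - 1)) * \<tau> ^ (B + Suc r)) (k - 1)"
    by (metis fps_mult_of_nat_nth(1))
  also have "\<dots> = (\<Sum>B=0..r. real ((B + r) choose r) * real ((r - B + q - 1) choose (q - 1)) * real ((k - 1 + B + r) choose (B + r)))"
    unfolding fps_sum_nth
    by (intro sum.cong refl, simp only: mult.assoc fps_mult_of_nat_nth(1) \<tau>_def add_Suc_right geom_power_nth) (simp add: add.assoc)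
  also have "\<dots> = (\<Sum>B=0..r. real ((r + k - 1) choose (k - 1)) *
      (real ((B + (r + k) - 1) choose (r + k - 1)) * real ((r - B + q - 1) choose (q - 1))))"
  proof (intro sum.cong refl)
    fix B
    have "(k - 1 + B + r) choose (B + r) = (B + r + k - 1) choose (k - 1)"
      using assms by (subst binomial_symmetric) (auto simp: algebra_simps)
    then show "real ((B + r) choose r) * real ((r - B + q - 1) choose (q - 1)) * real ((k - 1 + B + r) choose (B + r)) =
        real ((r + k - 1) choose (k - 1)) * (real ((B + (r + k) - 1) choose (r + k - 1)) * real ((r - B + q - 1) choose (q - 1)))"
      using arg_cong[OF choose_mult_choose[OF assms, of B r], of real] by simp
  qed
  \<comment> \<open>The sum over B is the coefficient of x^r in a product of two powers of 1/(1-x),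
    so the exponents just add.\<close>
  also have "\<dots> = real ((r + k - 1) choose (k - 1)) * fps_nth (geom 1 ^ (r + k) * geom (1 :: real) ^ q) r"
  proof -
    have "r + k \<ge> 1"
      using assms by simp
    then show ?thesis
      by (simp only: fps_mult_nth geom_1_power_nth q sum_distrib_left)
  qed
  also have "geom 1 ^ (r + k) * geom 1 ^ q = geom (1 :: real) ^ (r + k + q)"
    by (simp only: power_add)
  also have "fps_nth \<dots> r = real ((r + (r + k + q) - 1) choose (r + k + q - 1))"
    using q by (subst geom_1_power_nth) auto
  also have "(r + (r + k + q) - 1) choose (r + k + q - 1) = (r + (r + k + q) - 1) choose r"
    using q by (subst binomial_symmetric) auto
  also have "r + (r + k + q) - 1 = k * (r + 2) + 2 * r - 1"
    by (simp add: q_def algebra_simps)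
  finally show ?thesis
    by (simp only: h_def \<tau>_def)
qed

section \<open>Unimodular maps on finite products of Lebesgue measures\<close>

abbreviation lebesgue_prod :: "'i set \<Rightarrow> ('i \<Rightarrow> real) measure" where
  "lebesgue_prod I \<equiv> \<Pi>\<^sub>M i\<in>I. lborel"

interpretation lborel_product: product_sigma_finite "\<lambda>_::'i. lborel :: real measure"
  by standard

lemma sigma_finite_lebesgue_prod: "finite I \<Longrightarrow> sigma_finite_measure (lebesgue_prod I)"
  by (rule lborel_product.sigma_finite)

definition plus_on :: "'i set \<Rightarrow> ('i \<Rightarrow> real) \<Rightarrow> ('i \<Rightarrow> real) \<Rightarrow> 'i \<Rightarrow> real" where
  "plus_on I f g = (\<lambda>i\<in>I. f i + g i)"

lemma plus_on_measurable [measurable]: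
  assumes [measurable]: "f \<in> measurable M (lebesgue_prod I)" "g \<in> measurable M (lebesgue_prod I)"
  shows "(\<lambda>x. plus_on I (f x) (g x)) \<in> measurable M (lebesgue_prod I)"
proof -
  have [measurable]: "(\<lambda>x. f x i) \<in> borel_measurable M" "(\<lambda>x. g x i) \<in> borel_measurable M" if "i \<in> I" for i
    using measurable_compose[OF assms(1) measurable_component_singleton[OF that]]
      measurable_compose[OF assms(2) measurable_component_singleton[OF that]] by simp_all
  show ?thesis
    unfolding plus_on_def by measurable
qed

lemma distr_lebesgue_prod_translate:
  assumes "finite I" "g \<in> space (lebesgue_prod I)"
  shows "distr (lebesgue_prod I) (lebesgue_prod I) (plus_on I g) = lebesgue_prod I"
proof (rule lborel_product.PiM_eqI)
  fix A :: "'a \<Rightarrow> real set"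
  assume A: "\<And>i. i \<in> I \<Longrightarrow> A i \<in> sets lborel"
  have [measurable]: "plus_on I g \<in> measurable (lebesgue_prod I) (lebesgue_prod I)"
    using assms by measurable
  have AI: "Pi\<^sub>E I A \<in> sets (lebesgue_prod I)"
    using A assms by (intro sets_PiM_I_finite) auto
  have "plus_on I g -` Pi\<^sub>E I A \<inter> space (lebesgue_prod I) = Pi\<^sub>E I (\<lambda>i. (+) (g i) -` A i)"
    by (auto simp: plus_on_def space_PiM PiE_iff extensional_def)
  then have "emeasure (distr (lebesgue_prod I) (lebesgue_prod I) (plus_on I g)) (Pi\<^sub>E I A) =
      emeasure (lebesgue_prod I) (Pi\<^sub>E I (\<lambda>i. (+) (g i) -` A i))"
    using AI by (simp add: emeasure_distr)
  also have "\<dots> = (\<Prod>i\<in>I. emeasure lborel ((+) (g i) -` A i))"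
    using A assms measurable_sets[of "(+) (g i)" borel borel "A i" for i]
    by (intro lborel_product.emeasure_PiM) auto
  also have "\<dots> = (\<Prod>i\<in>I. emeasure lborel (A i))"
  proof (intro prod.cong refl)
    fix i assume "i \<in> I"
    then have "emeasure (distr lborel borel ((+) (g i))) (A i) = emeasure lborel ((+) (g i) -` A i)"
      using A by (subst emeasure_distr) auto
    then show "emeasure lborel ((+) (g i) -` A i) = emeasure lborel (A i)"
      by (simp add: lborel_distr_plus)
  qed
  finally show "emeasure (distr (lebesgue_prod I) (lebesgue_prod I) (plus_on I g)) (Pi\<^sub>E I A) =
      (\<Prod>i\<in>I. emeasure lborel (A i))" .
qed (use assms in auto)

lemma nn_integral_translate:
  assumes "finite I" "g \<in> space (lebesgue_prod I)" "f \<in> borel_measurable (lebesgue_prod I)"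
  shows "(\<integral>\<^sup>+c. f (plus_on I g c) \<partial>lebesgue_prod I) = (\<integral>\<^sup>+c. f c \<partial>lebesgue_prod I)"
proof -
  have "(\<integral>\<^sup>+c. f c \<partial>lebesgue_prod I) = (\<integral>\<^sup>+c. f c \<partial>distr (lebesgue_prod I) (lebesgue_prod I) (plus_on I g))"
    using assms by (simp add: distr_lebesgue_prod_translate)
  also have "\<dots> = (\<integral>\<^sup>+c. f (plus_on I g c) \<partial>lebesgue_prod I)"
    using assms by (intro nn_integral_distr plus_on_measurable) auto
  finally show ?thesis ..
qed

lemma emeasure_lebesgue_prod_scale:
  assumes "finite I" "t > 0" "A \<in> sets (lebesgue_prod I)"
  shows "emeasure (lebesgue_prod I) {c \<in> space (lebesgue_prod I). (\<lambda>i\<in>I. c i / t) \<in> A} =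
    ennreal (t ^ card I) * emeasure (lebesgue_prod I) A"
proof -
  have [measurable]: "(\<lambda>c. \<lambda>i\<in>I. c i / t) \<in> measurable (lebesgue_prod I) (lebesgue_prod I)"
    by measurable
  define \<mu> where "\<mu> = density (distr (lebesgue_prod I) (lebesgue_prod I) (\<lambda>c. \<lambda>i\<in>I. c i / t)) (\<lambda>_. ennreal ((1 / t) ^ card I))"
  have \<mu>: "emeasure \<mu> B = ennreal ((1 / t) ^ card I) *
      emeasure (lebesgue_prod I) {c \<in> space (lebesgue_prod I). (\<lambda>i\<in>I. c i / t) \<in> B}"
    if "B \<in> sets (lebesgue_prod I)" for B
  proof -
    have "{c \<in> space (lebesgue_prod I). (\<lambda>i\<in>I. c i / t) \<in> B} = (\<lambda>c. \<lambda>i\<in>I. c i / t) -` B \<inter> space (lebesgue_prod I)"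
      by auto
    then show ?thesis
      using that unfolding \<mu>_def by (subst emeasure_density_const) (simp_all add: emeasure_distr)
  qed
  have "\<mu> = lebesgue_prod I"
  proof (rule lborel_product.PiM_eqI)
    fix B :: "'a \<Rightarrow> real set"
    assume B: "\<And>i. i \<in> I \<Longrightarrow> B i \<in> sets lborel"
    have BI: "Pi\<^sub>E I B \<in> sets (lebesgue_prod I)"
      using B assms by (intro sets_PiM_I_finite) auto
    have *: "emeasure lborel ((\<lambda>x. x / t) -` B i) = ennreal t * emeasure lborel (B i)" if "i \<in> I" for i
    proof -
      have "emeasure (distr lborel borel ((*) (1 / t))) (B i) = emeasure lborel ((*) (1 / t) -` B i)"
        using B[OF that] by (subst emeasure_distr) auto
      moreover have "distr lborel borel ((*) (1 / t)) = density lborel (\<lambda>_. inverse \<bar>1 / t\<bar>)"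
        using assms by (intro lborel_distr_mult) auto
      moreover have "(*) (1 / t) = (\<lambda>x. x / t)"
        by auto
      ultimately show ?thesis
        using assms B[OF that] by (simp add: emeasure_density_const)
    qed
    have "{c \<in> space (lebesgue_prod I). (\<lambda>i\<in>I. c i / t) \<in> Pi\<^sub>E I B} = Pi\<^sub>E I (\<lambda>i. (\<lambda>x. x / t) -` B i)"
      by (auto simp: space_PiM PiE_iff extensional_def)
    then have "emeasure \<mu> (Pi\<^sub>E I B) = ennreal ((1 / t) ^ card I) *
        emeasure (lebesgue_prod I) (Pi\<^sub>E I (\<lambda>i. (\<lambda>x. x / t) -` B i))"
      using \<mu>[OF BI] by simp
    also have "emeasure (lebesgue_prod I) (Pi\<^sub>E I (\<lambda>i. (\<lambda>x. x / t) -` B i)) =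
        (\<Prod>i\<in>I. ennreal t * emeasure lborel (B i))"
      using B assms * measurable_sets[of "\<lambda>x. x / t" borel borel "B i" for i]
      by (subst lborel_product.emeasure_PiM) auto
    also have "\<dots> = ennreal (t ^ card I) * (\<Prod>i\<in>I. emeasure lborel (B i))"
      using assms by (simp add: prod.distrib ennreal_power)
    finally show "emeasure \<mu> (Pi\<^sub>E I B) = (\<Prod>i\<in>I. emeasure lborel (B i))"
      using assms by (simp add: mult.assoc[symmetric] ennreal_mult'[symmetric] power_mult_distrib[symmetric])
  qed (use assms in \<open>auto simp: \<mu>_def\<close>)
  with \<mu>[OF assms(3)] have "ennreal (t ^ card I) * emeasure (lebesgue_prod I) A = ennreal (t ^ card I) *
      (ennreal ((1 / t) ^ card I) * emeasure (lebesgue_prod I) {c \<in> space (lebesgue_prod I). (\<lambda>i\<in>I. c i / t) \<in> A})"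
    by simp
  then show ?thesis
    using assms by (simp add: mult.assoc[symmetric] ennreal_mult'[symmetric] power_mult_distrib[symmetric])
qed


lemma emeasure_lebesgue_prod_translate:
  assumes "finite I" "g \<in> space (lebesgue_prod I)" "A \<in> sets (lebesgue_prod I)"
  shows "emeasure (lebesgue_prod I) {c \<in> space (lebesgue_prod I). plus_on I g c \<in> A} = emeasure (lebesgue_prod I) A"
proof -
  have "plus_on I g \<in> measurable (lebesgue_prod I) (lebesgue_prod I)"
    using assms by (intro plus_on_measurable) auto
  moreover have "{c \<in> space (lebesgue_prod I). plus_on I g c \<in> A} = plus_on I g -` A \<inter> space (lebesgue_prod I)"
    by auto
  ultimately have "emeasure (lebesgue_prod I) {c \<in> space (lebesgue_prod I). plus_on I g c \<in> A} =
      emeasure (distr (lebesgue_prod I) (lebesgue_prod I) (plus_on I g)) A"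
    using assms by (simp add: emeasure_distr)
  then show ?thesis
    using assms by (simp add: distr_lebesgue_prod_translate)
qed

section \<open>Integer translates and fundamental domains\<close>

abbreviation int_points :: "'i set \<Rightarrow> ('i \<Rightarrow> real) set" where
  "int_points I \<equiv> I \<rightarrow>\<^sub>E \<int>"

definition unit_box :: "'i set \<Rightarrow> ('i \<Rightarrow> real) \<Rightarrow> ('i \<Rightarrow> real) set" where
  "unit_box I z = (\<Pi>\<^sub>E i\<in>I. {z i..<z i + 1})"

lemma unit_box_sets [measurable]: "finite I \<Longrightarrow> unit_box I z \<in> sets (lebesgue_prod I)"
  unfolding unit_box_def by (intro sets_PiM_I_finite) auto

lemma emeasure_unit_box: "finite I \<Longrightarrow> emeasure (lebesgue_prod I) (unit_box I z) = 1"
  unfolding unit_box_def by (subst lborel_product.emeasure_PiM) auto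

lemma unit_box_ex1:
  assumes "c \<in> space (lebesgue_prod I)"
  shows "\<exists>!z. z \<in> int_points I \<and> c \<in> unit_box I z"
proof (rule ex1I)
  show "(\<lambda>i\<in>I. of_int \<lfloor>c i\<rfloor>) \<in> int_points I \<and> c \<in> unit_box I (\<lambda>i\<in>I. of_int \<lfloor>c i\<rfloor>)"
    using assms by (auto simp: unit_box_def PiE_iff space_PiM)
next
  fix z assume z: "z \<in> int_points I \<and> c \<in> unit_box I z"
  show "z = (\<lambda>i\<in>I. of_int \<lfloor>c i\<rfloor>)"
  proof
    fix i
    show "z i = (\<lambda>i\<in>I. of_int \<lfloor>c i\<rfloor>) i"
    proof (cases "i \<in> I")
      case True
      then obtain m where "z i = of_int m"
        using z by (auto simp: PiE_iff Ints_def)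
      moreover have "z i \<le> c i" "c i < z i + 1"
        using z True by (auto simp: unit_box_def PiE_iff)
      ultimately show ?thesis
        using True by (simp add: floor_unique)
    qed (use z in \<open>auto simp: PiE_iff extensional_def\<close>)
  qed
qed

lemma countable_int_points: "finite I \<Longrightarrow> countable (int_points I)"
  by (intro countable_PiE) (auto simp: Ints_def)

text \<open>Cutting D along the integer unit boxes and translating each piece back to the cube Q at
  the origin covers Q exactly once, so D has the measure of Q.\<close>

lemma emeasure_fundamental_domain:
  assumes I: "finite I" and D [measurable]: "D \<in> sets (lebesgue_prod I)"
    and ex1: "\<And>c. c \<in> space (lebesgue_prod I) \<Longrightarrow> \<exists>!z. z \<in> int_points I \<and> plus_on I z c \<in> D"
  shows "emeasure (lebesgue_prod I) D = 1"
proof -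
  define Q where "Q = unit_box I (\<lambda>_. 0)"
  have Q [measurable]: "Q \<in> sets (lebesgue_prod I)"
    using I by (simp add: Q_def)
  have space: "D \<subseteq> space (lebesgue_prod I)" "Q \<subseteq> space (lebesgue_prod I)"
    using sets.sets_into_space[OF D] sets.sets_into_space[OF Q] by auto
  have int_space: "z \<in> space (lebesgue_prod I)" if "z \<in> int_points I" for z
    using that by (auto simp: space_PiM PiE_iff)
  have plus_space: "plus_on I z c \<in> space (lebesgue_prod I)" for z c
    by (auto simp: plus_on_def space_PiM)
  have box: "plus_on I z c \<in> unit_box I z \<longleftrightarrow> c \<in> Q" if "c \<in> space (lebesgue_prod I)" for z c
    using that by (auto simp: plus_on_def unit_box_def Q_def PiE_iff space_PiM)
  have Y: "{c \<in> space (lebesgue_prod I). plus_on I z c \<in> D} \<inter> Q \<in> sets (lebesgue_prod I)" if "z \<in> int_points I" for z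
  proof -
    have [measurable]: "plus_on I z \<in> measurable (lebesgue_prod I) (lebesgue_prod I)"
      using I int_space[OF that] by (intro plus_on_measurable) auto
    show ?thesis
      by measurable
  qed
  have D_Un: "(\<Union>z\<in>int_points I. D \<inter> unit_box I z) = D"
  proof (intro equalityI subsetI)
    fix c assume "c \<in> D"
    then have "c \<in> space (lebesgue_prod I)"
      using space by auto
    from unit_box_ex1[OF this] \<open>c \<in> D\<close> show "c \<in> (\<Union>z\<in>int_points I. D \<inter> unit_box I z)"
      by auto
  qed auto
  have D_disj: "disjoint_family_on (\<lambda>z. D \<inter> unit_box I z) (int_points I)"
    unfolding disjoint_family_on_def
  proof (intro ballI impI equals0I)
    fix m n c assume *: "m \<in> int_points I" "n \<in> int_points I" "m \<noteq> n" "c \<in> D \<inter> unit_box I m \<inter> (D \<inter> unit_box I n)"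
    then have "c \<in> space (lebesgue_prod I)"
      using space by auto
    from unit_box_ex1[OF this] * show False
      by auto
  qed
  define Y where "Y z = {c \<in> space (lebesgue_prod I). plus_on I z c \<in> D} \<inter> Q" for z
  have Y_Un: "(\<Union>z\<in>int_points I. Y z) = Q"
  proof (intro equalityI subsetI)
    fix c assume "c \<in> Q"
    then have c: "c \<in> space (lebesgue_prod I)"
      using space by auto
    from ex1[OF this] \<open>c \<in> Q\<close> c show "c \<in> (\<Union>z\<in>int_points I. Y z)"
      unfolding Y_def by auto
  qed (auto simp: Y_def)
  have Y_disj: "disjoint_family_on Y (int_points I)"
    unfolding disjoint_family_on_def
  proof (intro ballI impI equals0I)
    fix m n c assume *: "m \<in> int_points I" "n \<in> int_points I" "m \<noteq> n" "c \<in> Y m \<inter> Y n"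
    then have c: "c \<in> space (lebesgue_prod I)" "plus_on I m c \<in> D" "plus_on I n c \<in> D"
      by (auto simp: Y_def)
    from ex1[OF c(1)] * c show False
      by auto
  qed
  have "emeasure (lebesgue_prod I) D =
      (\<integral>\<^sup>+z. emeasure (lebesgue_prod I) (D \<inter> unit_box I z) \<partial>count_space (int_points I))"
    using emeasure_UN_countable[of "int_points I" "\<lambda>z. D \<inter> unit_box I z" "lebesgue_prod I"]
      I D_disj D unit_box_sets[OF I] countable_int_points[OF I]
    unfolding D_Un by (simp add: sets.Int)
  also have "\<dots> = (\<integral>\<^sup>+z. emeasure (lebesgue_prod I) ({c \<in> space (lebesgue_prod I). plus_on I z c \<in> D} \<inter> Q) \<partial>count_space (int_points I))"
  proof (intro nn_integral_cong)
    fix z assume "z \<in> space (count_space (int_points I))"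
    then have z: "z \<in> int_points I"
      by simp
    have "emeasure (lebesgue_prod I) (D \<inter> unit_box I z) =
        emeasure (lebesgue_prod I) {c \<in> space (lebesgue_prod I). plus_on I z c \<in> D \<inter> unit_box I z}"
      using I int_space[OF z] by (intro emeasure_lebesgue_prod_translate[symmetric]) auto
    also have "{c \<in> space (lebesgue_prod I). plus_on I z c \<in> D \<inter> unit_box I z} = {c \<in> space (lebesgue_prod I). plus_on I z c \<in> D} \<inter> Q"
      using box by auto
    finally show "emeasure (lebesgue_prod I) (D \<inter> unit_box I z) =
        emeasure (lebesgue_prod I) ({c \<in> space (lebesgue_prod I). plus_on I z c \<in> D} \<inter> Q)" .
  qed
  also have "\<dots> = emeasure (lebesgue_prod I) (\<Union>z\<in>int_points I. {c \<in> space (lebesgue_prod I). plus_on I z c \<in> D} \<inter> Q)"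
    using emeasure_UN_countable[of "int_points I" Y "lebesgue_prod I"]
      Y Y_disj countable_int_points[OF I] unfolding Y_def by simp
  also have "(\<Union>z\<in>int_points I. {c \<in> space (lebesgue_prod I). plus_on I z c \<in> D} \<inter> Q) = Q"
    using Y_Un by (simp add: Y_def)
  also have "emeasure (lebesgue_prod I) Q = 1"
    unfolding Q_def using I by (rule emeasure_unit_box)
  finally show ?thesis .
qed

text \<open>Averaging over a unit box shows that the image measure is a multiple of Lebesgue measure;
  the factor is the measure of a fundamental domain of the integer points.\<close>

lemma distr_lebesgue_prod_unimodular:
  fixes T :: "('i \<Rightarrow> real) \<Rightarrow> 'j \<Rightarrow> real"
  assumes I: "finite I" and J: "finite J"
    and T [measurable]: "T \<in> measurable (lebesgue_prod I) (lebesgue_prod J)"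
    and add: "\<And>c c'. c \<in> space (lebesgue_prod I) \<Longrightarrow> c' \<in> space (lebesgue_prod I) \<Longrightarrow>
        T (plus_on I c c') = plus_on J (T c) (T c')"
    and surj: "\<And>g. g \<in> space (lebesgue_prod J) \<Longrightarrow> \<exists>c\<in>space (lebesgue_prod I). T c = g"
    and bij: "bij_betw T (int_points I) (int_points J)"
  shows "distr (lebesgue_prod I) (lebesgue_prod J) T = lebesgue_prod J"
proof (rule measure_eqI)
  fix A assume "A \<in> sets (distr (lebesgue_prod I) (lebesgue_prod J) T)"
  then have A [measurable]: "A \<in> sets (lebesgue_prod J)"
    by simp
  interpret sigma_finite_measure "lebesgue_prod I"
    by (rule sigma_finite_lebesgue_prod[OF I])
  interpret sigma_finite_measure "lebesgue_prod J"
    by (rule sigma_finite_lebesgue_prod[OF J])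
  interpret pair_sigma_finite "lebesgue_prod I" "lebesgue_prod J" ..
  define Q where "Q = unit_box J (\<lambda>_. 0)"
  define neg :: "('j \<Rightarrow> real) \<Rightarrow> 'j \<Rightarrow> real" where "neg g = (\<lambda>j\<in>J. - g j)" for g
  have Q [measurable]: "Q \<in> sets (lebesgue_prod J)"
    using J by (simp add: Q_def)
  have T_space: "T c \<in> space (lebesgue_prod J)" if "c \<in> space (lebesgue_prod I)" for c
    using that T by (rule measurable_space[rotated])
  have neg_space: "neg g \<in> space (lebesgue_prod J)" for g
    by (auto simp: neg_def space_PiM)
  have neg_add: "plus_on J (neg g) (plus_on J g y) = y" "plus_on J g (plus_on J (neg g) y) = y"
    if "y \<in> space (lebesgue_prod J)" for g y
    using that by (auto simp: neg_def plus_on_def space_PiM PiE_iff extensional_def)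
  have [measurable]: "neg \<in> measurable (lebesgue_prod J) (lebesgue_prod J)"
    unfolding neg_def by measurable
  \<comment> \<open>Moving c by an integer point z moves y - T c by -T z. As T is a bijection of
    integer points, exactly one integer translate of c brings y - T c into Q.\<close>
  have domain: "emeasure (lebesgue_prod I) {c \<in> space (lebesgue_prod I). plus_on J (neg (T c)) y \<in> Q} = 1"
    if y: "y \<in> space (lebesgue_prod J)" for y
  proof (rule emeasure_fundamental_domain[OF I])
    show "{c \<in> space (lebesgue_prod I). plus_on J (neg (T c)) y \<in> Q} \<in> sets (lebesgue_prod I)"
      using y by measurable
    fix c assume c: "c \<in> space (lebesgue_prod I)"
    have iff: "plus_on J (neg (T (plus_on I z c))) y \<in> Q \<longleftrightarrow> plus_on J (neg (T c)) y \<in> unit_box J (T z)"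
      if "z \<in> int_points I" for z
    proof -
      have "z \<in> space (lebesgue_prod I)"
        using that by (auto simp: space_PiM PiE_iff)
      then have "T (plus_on I z c) = plus_on J (T z) (T c)"
        using c by (rule add)
      moreover have "plus_on J (neg (plus_on J (T z) (T c))) y \<in> Q \<longleftrightarrow> plus_on J (neg (T c)) y \<in> unit_box J (T z)"
        by (auto simp: plus_on_def neg_def unit_box_def Q_def PiE_iff algebra_simps)
      ultimately show ?thesis
        by simp
    qed
    have "\<exists>!g. g \<in> int_points J \<and> plus_on J (neg (T c)) y \<in> unit_box J g"
      by (rule unit_box_ex1) (auto simp: plus_on_def space_PiM)
    then obtain g where g: "g \<in> int_points J" "plus_on J (neg (T c)) y \<in> unit_box J g"
      and g_unique: "\<And>g'. g' \<in> int_points J \<Longrightarrow> plus_on J (neg (T c)) y \<in> unit_box J g' \<Longrightarrow> g' = g"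
      by (elim ex1E) blast
    obtain z where z: "z \<in> int_points I" "T z = g"
      using g(1) bij_betw_imp_surj_on[OF bij] by (metis imageE)
    have plus: "plus_on I z c \<in> space (lebesgue_prod I)" for z
      by (auto simp: plus_on_def space_PiM)
    show "\<exists>!z. z \<in> int_points I \<and>
        plus_on I z c \<in> {c \<in> space (lebesgue_prod I). plus_on J (neg (T c)) y \<in> Q}"
    proof (rule ex1I)
      show "z \<in> int_points I \<and> plus_on I z c \<in> {c \<in> space (lebesgue_prod I). plus_on J (neg (T c)) y \<in> Q}"
        using z g plus iff[OF z(1)] by simp
    next
      fix z' assume z': "z' \<in> int_points I \<and> plus_on I z' c \<in> {c \<in> space (lebesgue_prod I). plus_on J (neg (T c)) y \<in> Q}"
      then have "plus_on J (neg (T c)) y \<in> unit_box J (T z')"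
        using iff[of z'] by simp
      then have "T z' = T z"
        using g_unique z' z bij_betwE[OF bij] by simp
      then show "z' = z"
        using bij_betw_imp_inj_on[OF bij] z z' by (auto dest: inj_onD)
    qed
  qed
  have "emeasure (distr (lebesgue_prod I) (lebesgue_prod J) T) A = (\<integral>\<^sup>+c. indicator A (T c) \<partial>lebesgue_prod I)"
    by (simp add: nn_integral_distr flip: nn_integral_indicator)
  also have "\<dots> = (\<integral>\<^sup>+y. indicator Q y * (\<integral>\<^sup>+c. indicator A (T c) \<partial>lebesgue_prod I) \<partial>lebesgue_prod J)"
    using J by (simp add: nn_integral_multc Q_def emeasure_unit_box)
  \<comment> \<open>For each y, replacing c by c + d with T d = y leaves the inner integral
    unchanged. With y averaged over Q, Fubini then lets the translation pass from A to Q.\<close>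
  also have "\<dots> = (\<integral>\<^sup>+y. (\<integral>\<^sup>+c. indicator Q y * indicator A (plus_on J (T c) y) \<partial>lebesgue_prod I) \<partial>lebesgue_prod J)"
  proof (intro nn_integral_cong)
    fix y assume y: "y \<in> space (lebesgue_prod J)"
    then obtain d where d: "d \<in> space (lebesgue_prod I)" "T d = y"
      using surj by auto
    have "(\<integral>\<^sup>+c. indicator A (T c) \<partial>lebesgue_prod I) = (\<integral>\<^sup>+c. indicator A (T (plus_on I d c)) \<partial>lebesgue_prod I)"
      using I d by (intro nn_integral_translate[symmetric]) auto
    also have "\<dots> = (\<integral>\<^sup>+c. indicator A (plus_on J (T c) y) \<partial>lebesgue_prod I)"
    proof (intro nn_integral_cong)
      fix c assume "c \<in> space (lebesgue_prod I)"
      moreover have "plus_on J y (T c) = plus_on J (T c) y"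
        by (simp add: plus_on_def add.commute)
      ultimately show "indicator A (T (plus_on I d c)) = (indicator A (plus_on J (T c) y) :: ennreal)"
        using d by (simp add: add)
    qed
    finally show "indicator Q y * (\<integral>\<^sup>+c. indicator A (T c) \<partial>lebesgue_prod I) =
        (\<integral>\<^sup>+c. indicator Q y * indicator A (plus_on J (T c) y) \<partial>lebesgue_prod I)"
      using y by (simp add: nn_integral_cmult)
  qed
  also have "\<dots> = (\<integral>\<^sup>+c. (\<integral>\<^sup>+y. indicator Q y * indicator A (plus_on J (T c) y) \<partial>lebesgue_prod J) \<partial>lebesgue_prod I)"
    by (rule Fubini') measurable
  also have "\<dots> = (\<integral>\<^sup>+c. (\<integral>\<^sup>+y. indicator Q (plus_on J (neg (T c)) y) * indicator A y \<partial>lebesgue_prod J) \<partial>lebesgue_prod I)"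
  proof (rule nn_integral_cong)
    fix c assume c: "c \<in> space (lebesgue_prod I)"
    have "(\<integral>\<^sup>+y. indicator Q y * indicator A (plus_on J (T c) y) \<partial>lebesgue_prod J) =
        (\<integral>\<^sup>+y. indicator Q (plus_on J (neg (T c)) y) * indicator A (plus_on J (T c) (plus_on J (neg (T c)) y)) \<partial>lebesgue_prod J)"
      using J neg_space T_space[OF c] by (intro nn_integral_translate[symmetric]) measurable
    then show "(\<integral>\<^sup>+y. indicator Q y * indicator A (plus_on J (T c) y) \<partial>lebesgue_prod J) =
        (\<integral>\<^sup>+y. indicator Q (plus_on J (neg (T c)) y) * indicator A y \<partial>lebesgue_prod J)"
      by (simp add: neg_add cong: nn_integral_cong)
  qed
  also have "\<dots> = (\<integral>\<^sup>+y. (\<integral>\<^sup>+c. indicator Q (plus_on J (neg (T c)) y) * indicator A y \<partial>lebesgue_prod I) \<partial>lebesgue_prod J)"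
    by (rule Fubini'[symmetric]) measurable
  also have "\<dots> = (\<integral>\<^sup>+y. indicator A y \<partial>lebesgue_prod J)"
  proof (intro nn_integral_cong)
    fix y assume y: "y \<in> space (lebesgue_prod J)"
    have "(\<integral>\<^sup>+c. indicator Q (plus_on J (neg (T c)) y) * indicator A y \<partial>lebesgue_prod I) =
        (\<integral>\<^sup>+c. indicator {c \<in> space (lebesgue_prod I). plus_on J (neg (T c)) y \<in> Q} c * indicator A y \<partial>lebesgue_prod I)"
      by (intro nn_integral_cong) (auto simp: indicator_def)
    also have "\<dots> = emeasure (lebesgue_prod I) {c \<in> space (lebesgue_prod I). plus_on J (neg (T c)) y \<in> Q} * indicator A y"
      using y by (subst nn_integral_multc) auto
    finally show "(\<integral>\<^sup>+c. indicator Q (plus_on J (neg (T c)) y) * indicator A y \<partial>lebesgue_prod I) = indicator A y"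
      by (simp add: domain[OF y])
  qed
  finally show "emeasure (distr (lebesgue_prod I) (lebesgue_prod J) T) A = emeasure (lebesgue_prod J) A"
    by simp
qed simp

section \<open>Integration of one coordinate at a time\<close>

text \<open>
  The state is the pair \<open>(s, p)\<close> of the flow that has arrived along the spine and the flow that
  vertex 1 can still distribute. The operators stand for the edges whose coordinate \<open>v\<close> is
  integrated out: \<open>Free\<close> for an edge from the source that meets no further constraint,
  \<open>Budget\<close> for an edge \<open>(0, 1)\<close>, \<open>Inflow\<close> for \<open>(0, i)\<close>, \<open>Split\<close> for \<open>(1, i)\<close> and \<open>Pass\<close>
  for the spine edge \<open>(i, i + 1)\<close>, where \<open>2 \<le> i < n\<close>.
\<close>

datatype peel = Free | Budget | Inflow | Split | Pass

text \<open>Only source arcs enter \<tau>, so only they carry the exponential. A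
  \<open>Split\<close> may not exceed what vertex 1 has left, a \<open>Pass\<close> not what the
  current vertex has received; the arc to the last vertex takes the remainder.\<close>

definition peel_weight :: "peel \<Rightarrow> real \<times> real \<Rightarrow> real \<Rightarrow> ennreal" where
  "peel_weight op \<sigma> v = (case op of
      Split \<Rightarrow> (if 0 \<le> v \<and> v \<le> snd \<sigma> then 1 else 0)
    | Pass \<Rightarrow> (if 0 \<le> v \<and> v \<le> fst \<sigma> then 1 else 0)
    | _ \<Rightarrow> (if 0 \<le> v then ennreal (exp (- v)) else 0))"

definition peel_state :: "peel \<Rightarrow> real \<times> real \<Rightarrow> real \<Rightarrow> real \<times> real" where
  "peel_state op \<sigma> v = (case op of
      Free \<Rightarrow> \<sigma>
    | Budget \<Rightarrow> (fst \<sigma>, snd \<sigma> + v)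
    | Inflow \<Rightarrow> (fst \<sigma> + v, snd \<sigma>)
    | Split \<Rightarrow> (fst \<sigma> + v, snd \<sigma> - v)
    | Pass \<Rightarrow> (v, snd \<sigma>))"

primrec peel_density :: "(peel \<times> 'e) list \<Rightarrow> real \<times> real \<Rightarrow> ('e \<Rightarrow> real) \<Rightarrow> ennreal" where
  "peel_density [] \<sigma> f = 1"
| "peel_density (x # l) \<sigma> f =
    peel_weight (fst x) \<sigma> (f (snd x)) * peel_density l (peel_state (fst x) \<sigma> (f (snd x))) f"

definition transfer :: "peel \<Rightarrow> (real \<times> real \<Rightarrow> ennreal) \<Rightarrow> real \<times> real \<Rightarrow> ennreal" where
  "transfer op g \<sigma> = (\<integral>\<^sup>+v. peel_weight op \<sigma> v * g (peel_state op \<sigma> v) \<partial>lborel)"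

lemma measurable_peel_weight [measurable]:
  assumes [measurable]: "\<sigma> \<in> borel_measurable M" "v \<in> borel_measurable M"
  shows "(\<lambda>x. peel_weight op (\<sigma> x) (v x)) \<in> borel_measurable M"
proof -
  have [measurable]: "(\<lambda>x. fst (\<sigma> x)) \<in> borel_measurable M" "(\<lambda>x. snd (\<sigma> x)) \<in> borel_measurable M"
    using assms by (auto simp: borel_prod[symmetric])
  show ?thesis
    by (cases op) (simp_all add: peel_weight_def)
qed

lemma measurable_peel_state [measurable]:
  assumes [measurable]: "\<sigma> \<in> borel_measurable M" "v \<in> borel_measurable M"
  shows "(\<lambda>x. peel_state op (\<sigma> x) (v x)) \<in> borel_measurable M"
proof -
  have [measurable]: "(\<lambda>x. fst (\<sigma> x)) \<in> borel_measurable M" "(\<lambda>x. snd (\<sigma> x)) \<in> borel_measurable M"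
    using assms by (auto simp: borel_prod[symmetric])
  show ?thesis
    by (cases op) (simp_all add: peel_state_def)
qed

lemma measurable_peel_density:
  assumes "\<sigma> \<in> borel_measurable M" "\<And>e. e \<in> snd ` set l \<Longrightarrow> (\<lambda>x. F x e) \<in> borel_measurable M"
  shows "(\<lambda>x. peel_density l (\<sigma> x) (F x)) \<in> borel_measurable M"
  using assms
proof (induction l arbitrary: \<sigma>)
  case (Cons x l)
  have [measurable]: "(\<lambda>y. F y (snd x)) \<in> borel_measurable M"
    using Cons.prems by simp
  note [measurable] = Cons.prems(1)
  have [measurable]: "(\<lambda>y. peel_density l (peel_state (fst x) (\<sigma> y) (F y (snd x))) (F y)) \<in> borel_measurable M"
    by (intro Cons.IH) (use Cons.prems in auto)
  show ?case
    by simp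
qed simp

lemma peel_density_upd: "e \<notin> snd ` set l \<Longrightarrow> peel_density l \<sigma> (f(e := v)) = peel_density l \<sigma> f"
  by (induction l arbitrary: \<sigma>) auto

text \<open>Tonelli with the first arc outermost. Distinctness ensures that the rest of the density
  does not read the coordinate already fixed.\<close>

lemma nn_integral_peel_density:
  assumes "distinct (map snd l)"
  shows "(\<integral>\<^sup>+f. peel_density l \<sigma> f \<partial>lebesgue_prod (snd ` set l)) = foldr transfer (map fst l) (\<lambda>_. 1) \<sigma>"
  using assms
proof (induction l arbitrary: \<sigma>)
  case Nil
  show ?case
    by (simp add: PiM_empty nn_integral_count_space_finite)
next
  case (Cons x l)
  obtain op e where x: "x = (op, e)"
    by fastforce
  define I where "I = snd ` set l"
  have I: "finite I" "e \<notin> I" "snd ` set (x # l) = insert e I"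
    using Cons.prems by (auto simp: I_def x)
  note component = measurable_component_singleton[where M = "\<lambda>_. lborel", simplified]
  have meas: "(\<lambda>f. peel_density l \<tau> f) \<in> borel_measurable (lebesgue_prod I)" for \<tau>
  proof (rule measurable_peel_density)
    fix d assume "d \<in> snd ` set l"
    then show "(\<lambda>f. f d) \<in> borel_measurable (lebesgue_prod I)"
      unfolding I_def by (rule component)
  qed simp
  have meas': "peel_density (x # l) \<sigma> \<in> borel_measurable (lebesgue_prod (insert e I))"
  proof (rule measurable_peel_density)
    fix d assume "d \<in> snd ` set (x # l)"
    then show "(\<lambda>f. f d) \<in> borel_measurable (lebesgue_prod (insert e I))"
      unfolding I(3) by (rule component)
  qed simp
  have "(\<integral>\<^sup>+f. peel_density (x # l) \<sigma> f \<partial>lebesgue_prod (snd ` set (x # l))) =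
      (\<integral>\<^sup>+v. (\<integral>\<^sup>+f. peel_density (x # l) \<sigma> (f(e := v)) \<partial>lebesgue_prod I) \<partial>lborel)"
    unfolding I(3) by (rule lborel_product.product_nn_integral_insert_rev[OF I(1,2) meas'])
  also have "\<dots> = (\<integral>\<^sup>+v. (\<integral>\<^sup>+f. peel_weight op \<sigma> v * peel_density l (peel_state op \<sigma> v) f \<partial>lebesgue_prod I) \<partial>lborel)"
    using I by (simp add: x peel_density_upd I_def)
  also have "\<dots> = (\<integral>\<^sup>+v. peel_weight op \<sigma> v * foldr transfer (map fst l) (\<lambda>_. 1) (peel_state op \<sigma> v) \<partial>lborel)"
    using Cons.IH Cons.prems by (simp add: nn_integral_cmult meas flip: I_def)
  also have "\<dots> = foldr transfer (map fst (x # l)) (\<lambda>_. 1) \<sigma>"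
    by (simp add: x transfer_def)
  finally show ?case .
qed

lemma measurable_transfer [measurable]:
  assumes [measurable]: "g \<in> borel_measurable borel"
  shows "transfer op g \<in> borel_measurable borel"
  unfolding transfer_def by measurable

lemma measurable_foldr_transfer [measurable]:
  "g \<in> borel_measurable borel \<Longrightarrow> foldr transfer ops g \<in> borel_measurable borel"
  by (induction ops) auto

lemma transfer_sum:
  assumes [measurable]: "\<And>i. i \<in> A \<Longrightarrow> g i \<in> borel_measurable borel"
  shows "transfer op (\<lambda>\<sigma>. \<Sum>i\<in>A. g i \<sigma>) = (\<lambda>\<sigma>. \<Sum>i\<in>A. transfer op (g i) \<sigma>)"
  unfolding transfer_def by (rule ext) (simp add: sum_distrib_left nn_integral_sum)

lemma foldr_transfer_sum:
  assumes "\<And>i. i \<in> A \<Longrightarrow> g i \<in> borel_measurable borel"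
  shows "foldr transfer ops (\<lambda>\<sigma>. \<Sum>i\<in>A. g i \<sigma>) = (\<lambda>\<sigma>. \<Sum>i\<in>A. foldr transfer ops (g i) \<sigma>)"
  using assms by (induction ops) (simp_all add: transfer_sum)

section \<open>Shift rules on the quadrant of nonnegative states\<close>

definition quadrant_eq :: "(real \<times> real \<Rightarrow> ennreal) \<Rightarrow> (real \<times> real \<Rightarrow> ennreal) \<Rightarrow> bool" where
  "quadrant_eq g g' \<longleftrightarrow> (\<forall>s\<ge>0. \<forall>p\<ge>0. g (s, p) = g' (s, p))"

text \<open>The weights vanish unless the new state stays in the quadrant. Outside it the shift
  rules may fail: for s < 0 the \<open>Pass\<close> integral is empty, while an even power of s is
  positive.\<close>

lemma quadrant_eq_transfer:
  assumes "quadrant_eq g g'"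
  shows "quadrant_eq (transfer op g) (transfer op g')"
  unfolding quadrant_eq_def
proof (intro allI impI)
  fix s p :: real assume "s \<ge> 0" "p \<ge> 0"
  then have "peel_weight op (s, p) v * g (peel_state op (s, p) v) = peel_weight op (s, p) v * g' (peel_state op (s, p) v)" for v
    using assms by (cases op) (auto simp: peel_weight_def peel_state_def quadrant_eq_def)
  then show "transfer op g (s, p) = transfer op g' (s, p)"
    by (simp add: transfer_def)
qed

lemma quadrant_eq_foldr_transfer:
  "quadrant_eq g g' \<Longrightarrow> quadrant_eq (foldr transfer ops g) (foldr transfer ops g')"
  by (induction ops) (auto intro: quadrant_eq_transfer)

text \<open>Divided powers absorb all factorials: the binomial expansion, the Gamma integral and the
  Beta integral below all have coefficient 1.\<close>

definition dpow :: "nat \<Rightarrow> real \<Rightarrow> real" where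
  "dpow n x = x ^ n / fact n"

lemma dpow_nonneg [simp]: "0 \<le> x \<Longrightarrow> 0 \<le> dpow n x"
  by (simp add: dpow_def)

lemma dpow_0 [simp]: "dpow 0 x = 1" "dpow (Suc n) 0 = 0"
  by (simp_all add: dpow_def)

lemma measurable_dpow [measurable]: "dpow n \<in> borel_measurable borel"
  unfolding dpow_def by measurable

lemma DERIV_dpow: "(dpow (Suc n) has_real_derivative dpow n x) (at x)"
proof -
  have "((\<lambda>x. x ^ Suc n / fact (Suc n)) has_real_derivative (real (Suc n) * x ^ (Suc n - Suc 0)) / fact (Suc n)) (at x)"
    by (intro DERIV_cdivide DERIV_pow)
  moreover have "(real (Suc n) * x ^ (Suc n - Suc 0)) / fact (Suc n) = dpow n x"
    by (simp add: dpow_def divide_simps del: of_nat_Suc)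
  moreover have "(\<lambda>x. x ^ Suc n / fact (Suc n)) = dpow (Suc n)"
    by (simp add: dpow_def fun_eq_iff)
  ultimately show ?thesis
    by simp
qed

lemma DERIV_dpow_reflect: "((\<lambda>v. dpow (Suc n) (p - v)) has_real_derivative - dpow n (p - v)) (at v)"
proof -
  have "((\<lambda>v. p - v) has_real_derivative - 1) (at v)"
    by (auto intro!: derivative_eq_intros)
  from DERIV_chain'[OF this DERIV_dpow[of n "p - v"]] show ?thesis
    by simp
qed

lemma dpow_add: "dpow a (s + v) = (\<Sum>c\<le>a. dpow c v * dpow (a - c) s)"
proof -
  have "(v + s) ^ a / fact a = (\<Sum>c\<le>a. (of_nat (a choose c) * v ^ c * s ^ (a - c)) / fact a)"
    by (simp add: binomial_ring sum_divide_distrib)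
  also have "\<dots> = (\<Sum>c\<le>a. dpow c v * dpow (a - c) s)"
    by (intro sum.cong refl) (simp add: dpow_def binomial_fact field_simps)
  finally show ?thesis
    by (simp add: add.commute dpow_def)
qed

definition mon :: "nat \<Rightarrow> nat \<Rightarrow> real \<times> real \<Rightarrow> ennreal" where
  "mon a b \<sigma> = ennreal (dpow a (fst \<sigma>) * dpow b (snd \<sigma>))"

lemma measurable_mon [measurable]: "mon a b \<in> borel_measurable borel"
proof -
  have [measurable]: "fst \<in> borel_measurable (borel :: (real \<times> real) measure)" "snd \<in> borel_measurable (borel :: (real \<times> real) measure)"
    by (auto simp: borel_prod[symmetric])
  show ?thesis
    unfolding mon_def by measurable
qed

lemma exp_weight_moment:
  "(\<integral>\<^sup>+v. (if 0 \<le> v then ennreal (exp (- v)) else 0) * ennreal (dpow c v) \<partial>lborel) = 1"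
proof -
  have "(\<integral>\<^sup>+v. (if 0 \<le> v then ennreal (exp (- v)) else 0) * ennreal (dpow c v) \<partial>lborel) =
      (\<integral>\<^sup>+v. ennreal (1 / fact c) * (ennreal (v ^ c * exp (- v)) * indicator {0..} v) \<partial>lborel)"
    by (intro nn_integral_cong) (auto simp: dpow_def indicator_def ennreal_mult'[symmetric] field_simps)
  also have "\<dots> = 1"
    by (subst nn_integral_cmult) (auto simp: nn_intergal_power_times_exp_Ici ennreal_mult'[symmetric] simp flip: ennreal_of_nat_eq_real_of_nat)
  finally show ?thesis .
qed

lemma exp_weight_shifted_moment:
  fixes s :: real
  assumes "s \<ge> 0"
  shows "(\<integral>\<^sup>+v. (if 0 \<le> v then ennreal (exp (- v)) else 0) * ennreal (dpow a (s + v)) \<partial>lborel) =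
    (\<Sum>c\<le>a. ennreal (dpow (a - c) s))"
proof -
  have "(\<integral>\<^sup>+v. (if 0 \<le> v then ennreal (exp (- v)) else 0) * ennreal (dpow a (s + v)) \<partial>lborel) =
      (\<integral>\<^sup>+v. (\<Sum>c\<le>a. ennreal (dpow (a - c) s) *
        ((if 0 \<le> v then ennreal (exp (- v)) else 0) * ennreal (dpow c v))) \<partial>lborel)"
  proof (intro nn_integral_cong)
    fix v :: real
    show "(if 0 \<le> v then ennreal (exp (- v)) else 0) * ennreal (dpow a (s + v)) =
        (\<Sum>c\<le>a. ennreal (dpow (a - c) s) *
          ((if 0 \<le> v then ennreal (exp (- v)) else 0) * ennreal (dpow c v)))"
    proof (cases "0 \<le> v")
      case True
      then show ?thesis
        using assms unfolding dpow_add
        by (simp add: ennreal_mult sum_ennreal[symmetric] sum_distrib_left mult_ac del: sum_ennreal)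
    qed simp
  qed
  also have "\<dots> = (\<Sum>c\<le>a. ennreal (dpow (a - c) s) * 1)"
    by (subst nn_integral_sum) (simp_all add: nn_integral_cmult exp_weight_moment)
  finally show ?thesis
    by simp
qed

lemma ennreal_mult_mult_commute: "0 \<le> x \<Longrightarrow> 0 \<le> y \<Longrightarrow> w * ennreal (x * y) = ennreal y * (w * ennreal x)"
  by (simp add: ennreal_mult mult_ac)

lemma transfer_Free: "quadrant_eq (transfer Free (mon a b)) (mon a b)"
  using exp_weight_moment[of 0]
  by (auto simp: quadrant_eq_def transfer_def peel_weight_def peel_state_def nn_integral_multc)

lemma transfer_Inflow: "quadrant_eq (transfer Inflow (mon a b)) (\<lambda>\<sigma>. \<Sum>c\<le>a. mon (a - c) b \<sigma>)"
  unfolding quadrant_eq_def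
proof (intro allI impI)
  fix s p :: real assume s: "s \<ge> 0" and p: "p \<ge> 0"
  have "transfer Inflow (mon a b) (s, p) =
      (\<integral>\<^sup>+v. ennreal (dpow b p) * ((if 0 \<le> v then ennreal (exp (- v)) else 0) * ennreal (dpow a (s + v))) \<partial>lborel)"
    unfolding transfer_def using s p
    by (intro nn_integral_cong) (auto simp: peel_weight_def peel_state_def mon_def ennreal_mult_mult_commute)
  also have "\<dots> = ennreal (dpow b p) * (\<Sum>c\<le>a. ennreal (dpow (a - c) s))"
    by (subst nn_integral_cmult) (simp_all add: exp_weight_shifted_moment s)
  also have "\<dots> = (\<Sum>c\<le>a. mon (a - c) b (s, p))"
    using s p by (simp add: sum_distrib_left mon_def ennreal_mult mult.commute del: sum_ennreal)
  finally show "transfer Inflow (mon a b) (s, p) = (\<Sum>c\<le>a. mon (a - c) b (s, p))" .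
qed

lemma transfer_Budget: "quadrant_eq (transfer Budget (mon a b)) (\<lambda>\<sigma>. \<Sum>c\<le>b. mon a (b - c) \<sigma>)"
  unfolding quadrant_eq_def
proof (intro allI impI)
  fix s p :: real assume s: "s \<ge> 0" and p: "p \<ge> 0"
  have "transfer Budget (mon a b) (s, p) =
      (\<integral>\<^sup>+v. ennreal (dpow a s) * ((if 0 \<le> v then ennreal (exp (- v)) else 0) * ennreal (dpow b (p + v))) \<partial>lborel)"
    unfolding transfer_def using s p
    by (intro nn_integral_cong) (auto simp: peel_weight_def peel_state_def mon_def ennreal_mult mult_ac)
  also have "\<dots> = ennreal (dpow a s) * (\<Sum>c\<le>b. ennreal (dpow (b - c) p))"
    by (subst nn_integral_cmult) (simp_all add: exp_weight_shifted_moment p)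
  also have "\<dots> = (\<Sum>c\<le>b. mon a (b - c) (s, p))"
    using s p by (simp add: sum_distrib_left mon_def ennreal_mult del: sum_ennreal)
  finally show "transfer Budget (mon a b) (s, p) = (\<Sum>c\<le>b. mon a (b - c) (s, p))" .
qed

lemma transfer_Pass: "quadrant_eq (transfer Pass (mon a b)) (mon (Suc a) b)"
  unfolding quadrant_eq_def
proof (intro allI impI)
  fix s p :: real assume s: "s \<ge> 0" and p: "p \<ge> 0"
  have "transfer Pass (mon a b) (s, p) =
      (\<integral>\<^sup>+v. ennreal (dpow a v * dpow b p) * indicator {0..s} v \<partial>lborel)"
    unfolding transfer_def
    by (intro nn_integral_cong) (auto simp: peel_weight_def peel_state_def mon_def indicator_def)
  also have "\<dots> = ennreal (dpow (Suc a) s * dpow b p - dpow (Suc a) 0 * dpow b p)"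
    using s p by (intro nn_integral_FTC_Icc DERIV_cmult_right has_field_derivative_at_within[OF DERIV_dpow]) auto
  finally show "transfer Pass (mon a b) (s, p) = mon (Suc a) b (s, p)"
    by (simp add: mon_def)
qed

text \<open>Repeated integration by parts, trading a power of v for one of p - v. The antiderivative
  itself stays implicit, since only its values at 0 and p enter the integral.\<close>

lemma beta_antiderivative:
  fixes p :: real
  shows "\<exists>F. (\<forall>v. (F has_real_derivative (dpow c v * dpow b (p - v))) (at v)) \<and>
    F p = 0 \<and> F 0 = - dpow (b + c + 1) p"
proof (induction c arbitrary: b)
  case 0
  show ?case
    using DERIV_minus[OF DERIV_dpow_reflect[of b p]]
    by (intro exI[of _ "\<lambda>v. - dpow (Suc b) (p - v)"]) auto
next
  case (Suc c)
  obtain F where F: "\<And>v. (F has_real_derivative (dpow c v * dpow (Suc b) (p - v))) (at v)"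
      "F p = 0" "F 0 = - dpow (Suc b + c + 1) p"
    using Suc[of "Suc b"] by blast
  define G where "G v = F v - dpow (Suc c) v * dpow (Suc b) (p - v)" for v
  have "(G has_real_derivative dpow c v * dpow (Suc b) (p - v) -
      (dpow c v * dpow (Suc b) (p - v) + - dpow b (p - v) * dpow (Suc c) v)) (at v)" for v
    unfolding G_def by (intro DERIV_diff DERIV_mult F(1) DERIV_dpow DERIV_dpow_reflect)
  then have "(G has_real_derivative dpow (Suc c) v * dpow b (p - v)) (at v)" for v
    by (simp add: mult.commute)
  moreover have "G p = 0" "G 0 = - dpow (b + Suc c + 1) p"
    using F by (simp_all add: G_def)
  ultimately show ?case
    by blast
qed

lemma nn_integral_beta:
  assumes "p \<ge> 0"
  shows "(\<integral>\<^sup>+v. ennreal (dpow c v * dpow b (p - v)) * indicator {0..p} v \<partial>lborel) =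
    ennreal (dpow (b + c + 1) p)"
proof -
  obtain F where F: "\<And>v. (F has_real_derivative (dpow c v * dpow b (p - v))) (at v)"
      "F p = 0" "F 0 = - dpow (b + c + 1) p"
    using beta_antiderivative by blast
  have "(\<integral>\<^sup>+v. ennreal (dpow c v * dpow b (p - v)) * indicator {0..p} v \<partial>lborel) = ennreal (F p - F 0)"
    using F(1) assms by (intro nn_integral_FTC_Icc) (auto intro: has_field_derivative_at_within)
  then show ?thesis
    by (simp add: F)
qed

text \<open>Expanding the power of s + v gives one Beta integral for each c, which merges degree c
  in v and degree b in p - v into degree b + c + 1 in p. What a loses, plus one, goes to b.\<close>

lemma transfer_Split: "quadrant_eq (transfer Split (mon a b)) (\<lambda>\<sigma>. \<Sum>c\<le>a. mon (a - c) (b + c + 1) \<sigma>)"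
  unfolding quadrant_eq_def
proof (intro allI impI)
  fix s p :: real assume s: "s \<ge> 0" and p: "p \<ge> 0"
  have "transfer Split (mon a b) (s, p) =
      (\<integral>\<^sup>+v. (\<Sum>c\<le>a. ennreal (dpow (a - c) s) *
        (ennreal (dpow c v * dpow b (p - v)) * indicator {0..p} v)) \<partial>lborel)"
    unfolding transfer_def
  proof (intro nn_integral_cong)
    fix v
    have *: "ennreal (dpow a (s + v) * dpow b (p - v)) =
        (\<Sum>c\<le>a. ennreal (dpow (a - c) s) * ennreal (dpow c v * dpow b (p - v)))"
      if "0 \<le> v" "v \<le> p"
    proof -
      have "dpow a (s + v) * dpow b (p - v) = (\<Sum>c\<le>a. dpow (a - c) s * (dpow c v * dpow b (p - v)))"
        by (simp add: dpow_add sum_distrib_left mult_ac)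
      then show ?thesis
        using s that by (simp add: ennreal_mult[symmetric])
    qed
    show "peel_weight Split (s, p) v * mon a b (peel_state Split (s, p) v) =
        (\<Sum>c\<le>a. ennreal (dpow (a - c) s) *
          (ennreal (dpow c v * dpow b (p - v)) * indicator {0..p} v))"
      using * by (auto simp: peel_weight_def peel_state_def mon_def indicator_def)
  qed
  also have "\<dots> = (\<Sum>c\<le>a. ennreal (dpow (a - c) s) * ennreal (dpow (b + c + 1) p))"
    by (subst nn_integral_sum) (auto simp: nn_integral_cmult nn_integral_beta[OF p])
  also have "\<dots> = (\<Sum>c\<le>a. mon (a - c) (b + c + 1) (s, p))"
    using s p by (simp add: mon_def ennreal_mult)
  finally show "transfer Split (mon a b) (s, p) = (\<Sum>c\<le>a. mon (a - c) (b + c + 1) (s, p))" .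
qed

section \<open>Words of operators evaluated at the empty state\<close>

definition transfer_value :: "peel list \<Rightarrow> nat \<Rightarrow> nat \<Rightarrow> ennreal" where
  "transfer_value ops a b = foldr transfer ops (mon a b) (0, 0)"

text \<open>\<open>foldr\<close> applies the last operator to the monomial first, so the value of
  the longer word is a sum of values of the shorter one on shifted monomials. This is why words grow
  on the right.\<close>

lemma transfer_value_snoc:
  assumes "quadrant_eq (transfer op (mon a b)) (\<lambda>\<sigma>. \<Sum>i\<in>A. mon (\<alpha> i) (\<beta> i) \<sigma>)"
  shows "transfer_value (ops @ [op]) a b = (\<Sum>i\<in>A. transfer_value ops (\<alpha> i) (\<beta> i))"
proof -
  have "transfer_value (ops @ [op]) a b = foldr transfer ops (\<lambda>\<sigma>. \<Sum>i\<in>A. mon (\<alpha> i) (\<beta> i) \<sigma>) (0, 0)"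
    using quadrant_eq_foldr_transfer[OF assms, of ops] by (simp add: transfer_value_def quadrant_eq_def)
  then show ?thesis
    by (simp add: foldr_transfer_sum transfer_value_def)
qed

lemma transfer_value_snoc1:
  assumes "quadrant_eq (transfer op (mon a b)) (mon a' b')"
  shows "transfer_value (ops @ [op]) a b = transfer_value ops a' b'"
  using transfer_value_snoc[of op a b "\<lambda>_. a'" "\<lambda>_. b'" "{()}" ops] assms by simp

lemma geom_1_power_nonneg: "0 \<le> fps_nth (geom (1 :: real) ^ j) b"
proof (cases j)
  case (Suc m)
  then show ?thesis
    using geom_power_nth[of "1 :: real" m b] by (simp del: power_Suc)
qed simp

text \<open>At (0, 0) only a = b = 0 survives. \<open>Free\<close> integrates to 1, and each
  \<open>Budget\<close> replaces the values by partial sums in b, which multiplies their series by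
  1/(1-x).\<close>

lemma transfer_value_start:
  "transfer_value (replicate m Free @ replicate j Budget) a b =
    ennreal (if a = 0 then fps_nth (geom 1 ^ j) b else 0)"
proof (induction j arbitrary: b)
  case 0
  show ?case
  proof (induction m)
    case 0
    show ?case
      by (cases a; cases b) (simp_all add: transfer_value_def mon_def)
  next
    case (Suc m)
    then show ?case
      using transfer_value_snoc1[OF transfer_Free, of "replicate m Free" a b]
      by (simp add: replicate_append_same)
  qed
next
  case (Suc j)
  have "replicate m Free @ replicate (Suc j) Budget = (replicate m Free @ replicate j Budget) @ [Budget]"
    by (simp add: replicate_append_same)
  then have "transfer_value (replicate m Free @ replicate (Suc j) Budget) a b =
      (\<Sum>c\<le>b. ennreal (if a = 0 then fps_nth (geom 1 ^ j) (b - c) else 0))"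
    by (simp only: transfer_value_snoc[OF transfer_Budget] Suc.IH)
  also have "\<dots> = ennreal (\<Sum>c\<le>b. if a = 0 then fps_nth (geom 1 ^ j) (b - c) else 0)"
    by (intro sum_ennreal) (simp add: geom_1_power_nonneg)
  also have "(\<Sum>c\<le>b. if a = 0 then fps_nth (geom 1 ^ j) (b - c) else 0) =
      (if a = 0 then fps_nth (geom (1 :: real) ^ Suc j) b else 0)"
    by (auto simp: fps_mult_nth atLeast0AtMost)
  finally show ?case .
qed

text \<open>A word of operators is encoded by a series \<open>A\<close> over the ring of real series: \<open>x\<close> marks the
  exponent of the first coordinate, and the exponent \<open>b\<close> of the second one enters only through
  the power \<open>(1 - u)\<^sup>-\<^sup>b\<^sup>-\<^sup>1\<close>, because it starts out as
  \<open>(k - 1 + b) choose b = [u\<^sup>k\<^sup>-\<^sup>1] (1 - u)\<^sup>-\<^sup>b\<^sup>-\<^sup>1\<close>.\<close>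

definition represents :: "nat \<Rightarrow> peel list \<Rightarrow> real fps fps \<Rightarrow> bool" where
  "represents k ops A \<longleftrightarrow> (\<forall>a b.
    transfer_value ops a b = ennreal (fps_nth (geom 1 ^ Suc b * fps_nth A a) (k - 1)) \<and>
    0 \<le> fps_nth (geom 1 ^ Suc b * fps_nth A a) (k - 1))"

text \<open>The number (k-1+b) choose b is the coefficient of x^b in (1-x)^(-k) and also that of
  u^(k-1) in (1-u)^(-b-1). This exchange turns b from an index into an exponent.\<close>

lemma represents_start:
  assumes "k \<ge> 1"
  shows "represents k (replicate m Free @ replicate k Budget) 1"
proof -
  have "fps_nth (geom 1 ^ Suc b) (k - 1) = fps_nth (geom (1::real) ^ k) b" for b
  proof -
    have "(k - 1 + b) choose b = (b + k - 1) choose (k - 1)"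
      using assms by (subst binomial_symmetric) (auto simp: add.commute)
    then show ?thesis
      by (simp only: geom_power_nth geom_1_power_nth[OF assms]) simp
  qed
  then show ?thesis
    by (simp add: represents_def transfer_value_start geom_1_power_nonneg del: power_Suc)
qed

text \<open>Covers \<open>Inflow\<close>, where \<open>\<beta> b c\<close> is b, and
  \<open>Split\<close>, where it is b + c + 1. The nonnegativity recorded in
  \<open>represents\<close> allows the sum to move inside \<open>ennreal\<close>.\<close>

lemma represents_snoc:
  assumes "represents k ops A"
    and "\<And>a b. quadrant_eq (transfer op (mon a b)) (\<lambda>\<sigma>. \<Sum>c\<le>a. mon (a - c) (\<beta> b c) \<sigma>)"
    and "\<And>a b. geom 1 ^ Suc b * fps_nth A' a = (\<Sum>c\<le>a. geom 1 ^ Suc (\<beta> b c) * fps_nth A (a - c))"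
  shows "represents k (ops @ [op]) A'"
  unfolding represents_def
proof (intro allI)
  fix a b
  have A: "transfer_value ops a b = ennreal (fps_nth (geom 1 ^ Suc b * fps_nth A a) (k - 1))"
    "0 \<le> fps_nth (geom 1 ^ Suc b * fps_nth A a) (k - 1)" for a b
    using assms(1) unfolding represents_def by blast+
  show "transfer_value (ops @ [op]) a b = ennreal (fps_nth (geom 1 ^ Suc b * fps_nth A' a) (k - 1)) \<and>
      0 \<le> fps_nth (geom 1 ^ Suc b * fps_nth A' a) (k - 1)"
    unfolding transfer_value_snoc[OF assms(2)] assms(3) fps_sum_nth A(1)
    by (simp only: sum_ennreal A(2) sum_nonneg)
qed

lemma represents_Inflow: "represents k ops A \<Longrightarrow> represents k (ops @ [Inflow]) (geom 1 * A)"
  by (rule represents_snoc[OF _ transfer_Inflow])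
     (simp_all add: fps_mult_nth[of "geom 1" A] sum_distrib_left atLeast0AtMost)

text \<open>Lowering a by c raises b by c + 1, which costs t^(c+1); summed over c this is
  multiplication by t/(1 - t x).\<close>

lemma represents_Split:
  "represents k ops A \<Longrightarrow> represents k (ops @ [Split]) (fps_const (geom 1) * geom (geom 1) * A)"
proof (rule represents_snoc[OF _ transfer_Split])
  fix a b
  have "fps_nth (fps_const (geom 1) * geom (geom 1) * A) a = geom 1 * (\<Sum>c\<le>a. geom 1 ^ c * fps_nth A (a - c))"
    by (simp only: mult.assoc fps_mult_left_const_nth fps_mult_nth[of "geom _"] geom_nth atLeast0AtMost)
  then show "geom 1 ^ Suc b * fps_nth (fps_const (geom 1) * geom (geom 1) * A) a =
      (\<Sum>c\<le>a. geom 1 ^ Suc (b + c + 1) * fps_nth A (a - c))"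
    by (simp add: sum_distrib_left power_add mult_ac)
qed

lemma represents_Pass: "represents k ops A \<Longrightarrow> represents k (ops @ [Pass]) (fps_shift 1 A)"
  unfolding represents_def by (simp add: transfer_value_snoc1[OF transfer_Pass])

lemma represents_replicate_Inflow:
  assumes "represents k ops A"
  shows "represents k (ops @ replicate m Inflow) (geom 1 ^ m * A)"
proof (induction m)
  case (Suc m)
  then have "represents k ((ops @ replicate m Inflow) @ [Inflow]) (geom 1 * (geom 1 ^ m * A))"
    by (rule represents_Inflow)
  then show ?case
    by (simp add: replicate_append_same mult.assoc)
qed (use assms in simp)

abbreviation block :: "nat \<Rightarrow> peel list" where
  "block k \<equiv> Split # replicate k Inflow @ [Pass]"

lemma represents_block:
  assumes "represents k ops A"
  shows "represents k (ops @ block k) (fps_const (geom 1) * excursion_step (block_series k) A)"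
proof -
  have "represents k (((ops @ [Split]) @ replicate k Inflow) @ [Pass])
      (fps_shift 1 (geom 1 ^ k * (fps_const (geom 1) * geom (geom 1) * A)))"
    by (intro represents_Pass represents_replicate_Inflow represents_Split assms)
  moreover have "fps_shift 1 (geom 1 ^ k * (fps_const (geom 1) * geom (geom 1) * A)) =
      fps_shift 1 (fps_const (geom 1) * (block_series k * A))"
    by (simp only: block_series_def mult_ac)
  moreover have "\<dots> = fps_const (geom 1) * excursion_step (block_series k) A"
    by (rule fps_ext) (simp add: excursion_step_def)
  ultimately show ?thesis
    by simp
qed

lemma represents_blocks:
  assumes "represents k ops A"
  shows "represents k (ops @ concat (replicate r (block k)))
    (fps_const (geom 1 ^ r) * (excursion_step (block_series k) ^^ r) A)"
proof (induction r)
  case (Suc r)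
  have "concat (replicate (Suc r) (block k)) = concat (replicate r (block k)) @ block k"
    by (induction r) auto
  moreover have "excursion_step h (fps_const t * B) = fps_const t * excursion_step h B"
    for h B and t :: "real fps"
    unfolding excursion_step_def mult.left_commute[of h] by (rule fps_ext) simp
  ultimately show ?case
    using represents_block[OF Suc] by (simp add: mult.assoc[symmetric] del: replicate_Suc)
qed (use assms in simp)

lemma mon_0_0: "mon 0 0 = (\<lambda>_. 1)"
  by (simp add: mon_def fun_eq_iff)

lemma transfer_caracol:
  assumes "k \<ge> 1"
  shows "foldr transfer (replicate m Free @ replicate k Budget @ concat (replicate r (block k))) (\<lambda>_. 1) (0, 0) =
    ennreal (real ((r + k - 1) choose (k - 1)) * real ((k * (r + 2) + 2 * r - 1) choose r) / real (Suc r))"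
proof -
  have "represents k ((replicate m Free @ replicate k Budget) @ concat (replicate r (block k)))
      (fps_const (geom 1 ^ r) * (excursion_step (block_series k) ^^ r) 1)"
    by (intro represents_blocks represents_start assms)
  then have "transfer_value ((replicate m Free @ replicate k Budget) @ concat (replicate r (block k))) 0 0 =
      ennreal (fps_nth (geom 1 ^ Suc 0 * fps_nth (fps_const (geom 1 ^ r) * (excursion_step (block_series k) ^^ r) 1) 0) (k - 1))"
    unfolding represents_def by blast
  also have "geom 1 ^ Suc 0 * fps_nth (fps_const (geom 1 ^ r) * (excursion_step (block_series k) ^^ r) 1) 0 =
      geom 1 ^ Suc r * fps_nth ((excursion_step (block_series k) ^^ r) 1) 0"
    by (simp add: mult.assoc)
  also have "fps_nth \<dots> (k - 1) =
      real ((r + k - 1) choose (k - 1)) * real ((k * (r + 2) + 2 * r - 1) choose r) / real (Suc r)"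
    using caracol_excursions[OF assms, of r] by (simp add: field_simps del: of_nat_Suc power_Suc)
  finally show ?thesis
    using mon_0_0 by (simp add: transfer_value_def)
qed

section \<open>Cones and lattice coordinates\<close>

lemma nn_integral_exp_tail: "(\<integral>\<^sup>+t. ennreal (exp (- t)) * indicator {x..} t \<partial>lborel) = ennreal (exp (- x))"
proof -
  have "((\<lambda>t::real. - exp (- t)) \<longlongrightarrow> - 0) at_top"
    by (intro tendsto_minus filterlim_compose[OF exp_at_bot] filterlim_uminus_at_bot_at_top)
  then have "(\<integral>\<^sup>+t. ennreal (exp (- t)) * indicator {x..} t \<partial>lborel) = ennreal (0 - - exp (- x))"
    by (intro nn_integral_FTC_atLeast) (auto intro!: derivative_eq_intros)
  then show ?thesis
    by simp
qed

text \<open>Write exp(-\<tau>) as the integral of exp(-t) over t \<ge> \<tau> and exchange the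
  integrals. The slice \<tau> \<le> t is the slice \<tau> \<le> 1 scaled by t, and the integral of
  t^d exp(-t) supplies d!.\<close>

lemma emeasure_cone:
  assumes I: "finite I" and C [measurable]: "C \<in> sets (lebesgue_prod I)"
    and \<tau> [measurable]: "\<tau> \<in> borel_measurable (lebesgue_prod I)"
    and nonneg: "\<And>c. c \<in> C \<Longrightarrow> 0 \<le> \<tau> c"
    and C_scale: "\<And>c t. c \<in> space (lebesgue_prod I) \<Longrightarrow> 0 < t \<Longrightarrow> (\<lambda>i\<in>I. c i / t) \<in> C \<longleftrightarrow> c \<in> C"
    and \<tau>_scale: "\<And>c t. c \<in> space (lebesgue_prod I) \<Longrightarrow> 0 < t \<Longrightarrow> \<tau> (\<lambda>i\<in>I. c i / t) = \<tau> c / t"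
  shows "(\<integral>\<^sup>+c. indicator C c * ennreal (exp (- \<tau> c)) \<partial>lebesgue_prod I) =
    ennreal (fact (card I)) * emeasure (lebesgue_prod I) {c \<in> C. \<tau> c \<le> 1}"
proof -
  interpret sigma_finite_measure "lebesgue_prod I"
    by (rule sigma_finite_lebesgue_prod[OF I])
  interpret pair_sigma_finite lborel "lebesgue_prod I" ..
  have C_space: "C \<subseteq> space (lebesgue_prod I)"
    using sets.sets_into_space[OF C] .
  have C_le: "{c \<in> C. \<tau> c \<le> t} \<in> sets (lebesgue_prod I)" for t
  proof -
    have "{c \<in> C. \<tau> c \<le> t} = {c \<in> space (lebesgue_prod I). c \<in> C \<and> \<tau> c \<le> t}"
      using C_space by auto
    then show ?thesis
      by simp
  qed
  have "(\<integral>\<^sup>+c. indicator C c * ennreal (exp (- \<tau> c)) \<partial>lebesgue_prod I) =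
      (\<integral>\<^sup>+c. (\<integral>\<^sup>+t. (if c \<in> C \<and> \<tau> c \<le> t then ennreal (exp (- t)) else 0) \<partial>lborel) \<partial>lebesgue_prod I)"
  proof (rule nn_integral_cong)
    fix c
    have "(\<integral>\<^sup>+t. (if c \<in> C \<and> \<tau> c \<le> t then ennreal (exp (- t)) else 0) \<partial>lborel) =
        (\<integral>\<^sup>+t. indicator C c * (ennreal (exp (- t)) * indicator {\<tau> c..} t) \<partial>lborel)"
      by (rule nn_integral_cong) (auto simp: indicator_def)
    then show "indicator C c * ennreal (exp (- \<tau> c)) =
        (\<integral>\<^sup>+t. (if c \<in> C \<and> \<tau> c \<le> t then ennreal (exp (- t)) else 0) \<partial>lborel)"
      by (simp add: nn_integral_cmult nn_integral_exp_tail)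
  qed
  also have "\<dots> = (\<integral>\<^sup>+t. (\<integral>\<^sup>+c. (if c \<in> C \<and> \<tau> c \<le> t then ennreal (exp (- t)) else 0) \<partial>lebesgue_prod I) \<partial>lborel)"
    by (rule Fubini') measurable
  also have "\<dots> = (\<integral>\<^sup>+t. (ennreal (t ^ card I * exp (- t)) * indicator {0..} t) *
      emeasure (lebesgue_prod I) {c \<in> C. \<tau> c \<le> 1} \<partial>lborel)"
  \<comment> \<open>For t > 0 scaling applies and for t < 0 the slice is empty; t = 0 falls under
    neither case and is discarded as a null set.\<close>
  proof (rule nn_integral_cong_AE)
    have "(\<integral>\<^sup>+c. (if c \<in> C \<and> \<tau> c \<le> t then ennreal (exp (- t)) else 0) \<partial>lebesgue_prod I) =
        (ennreal (t ^ card I * exp (- t)) * indicator {0..} t) * emeasure (lebesgue_prod I) {c \<in> C. \<tau> c \<le> 1}"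
      if "t \<noteq> 0" for t
    proof -
      have "(\<integral>\<^sup>+c. (if c \<in> C \<and> \<tau> c \<le> t then ennreal (exp (- t)) else 0) \<partial>lebesgue_prod I) =
          (\<integral>\<^sup>+c. ennreal (exp (- t)) * indicator {c \<in> C. \<tau> c \<le> t} c \<partial>lebesgue_prod I)"
        by (rule nn_integral_cong) (auto simp: indicator_def)
      also have "\<dots> = ennreal (exp (- t)) * emeasure (lebesgue_prod I) {c \<in> C. \<tau> c \<le> t}"
        using C_le by (rule nn_integral_cmult_indicator)
      also have "\<dots> = (ennreal (t ^ card I * exp (- t)) * indicator {0..} t) * emeasure (lebesgue_prod I) {c \<in> C. \<tau> c \<le> 1}"
      proof (cases "t > 0")
        case True
        have "{c \<in> C. \<tau> c \<le> t} = {c \<in> space (lebesgue_prod I). (\<lambda>i\<in>I. c i / t) \<in> {c \<in> C. \<tau> c \<le> 1}}"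
          using True C_space C_scale \<tau>_scale by auto
        then show ?thesis
          using True emeasure_lebesgue_prod_scale[OF I True C_le[of 1]]
          by (simp add: ennreal_mult mult_ac)
      next
        case False
        then have empty: "{c \<in> C. \<tau> c \<le> t} = {}"
          using nonneg that by force
        show ?thesis
          using False that unfolding empty by (simp add: indicator_def)
      qed
      finally show ?thesis .
    qed
    then show "AE t in lborel. (\<integral>\<^sup>+c. (if c \<in> C \<and> \<tau> c \<le> t then ennreal (exp (- t)) else 0) \<partial>lebesgue_prod I) =
        (ennreal (t ^ card I * exp (- t)) * indicator {0..} t) * emeasure (lebesgue_prod I) {c \<in> C. \<tau> c \<le> 1}"
      using AE_lborel_singleton[of "0::real"] by (auto elim!: eventually_mono)
  qed
  also have "\<dots> = ennreal (fact (card I)) * emeasure (lebesgue_prod I) {c \<in> C. \<tau> c \<le> 1}"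
    by (subst nn_integral_multc) (simp_all add: nn_intergal_power_times_exp_Ici)
  finally show ?thesis .
qed

section \<open>Lattices parametrised by a set of free coordinates\<close>

definition unit_vector :: "'b \<Rightarrow> 'b \<Rightarrow> real" where
  "unit_vector j = (\<lambda>e. if e = j then 1 else 0)"

text \<open>\<open>E\<close> rebuilds a vector from its entries on \<open>J\<close>. Linearity and
  integrality make \<open>ext_lattice\<close> a copy of the integer points on \<open>J\<close>, so
  that these entries can replace coordinates in a lattice basis.\<close>

locale integral_extension =
  fixes J :: "'b set" and E :: "('b \<Rightarrow> real) \<Rightarrow> 'b \<Rightarrow> real"
  assumes finite_J: "finite J"
    and E_free: "j \<in> J \<Longrightarrow> E f j = f j"
    and E_cong: "(\<And>j. j \<in> J \<Longrightarrow> f j = g j) \<Longrightarrow> E f = E g"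
    and E_add: "E (\<lambda>e. f e + g e) = (\<lambda>e. E f e + E g e)"
    and E_scale: "E (\<lambda>e. t * f e) = (\<lambda>e. t * E f e)"
    and E_int: "(\<And>j. j \<in> J \<Longrightarrow> f j \<in> \<int>) \<Longrightarrow> E f e \<in> \<int>"
begin

definition ext_lattice :: "('b \<Rightarrow> real) set" where
  "ext_lattice = {E f | f. \<forall>j\<in>J. f j \<in> \<int>}"

lemma E_zero: "E (\<lambda>_. 0) = (\<lambda>_. 0)"
  using E_scale[of 0 "\<lambda>_. 0"] by simp

lemma E_sum: "E (\<lambda>e. \<Sum>i<d. c i * g i e) = (\<lambda>e. \<Sum>i<(d::nat). c i * E (g i) e)"
  by (induction d) (simp_all add: E_zero E_add E_scale)

lemma E_expand: "E f e = (\<Sum>j\<in>J. f j * E (unit_vector j) e)"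
proof -
  have "E (\<lambda>e. \<Sum>j\<in>K. f j * unit_vector j e) = (\<lambda>e. \<Sum>j\<in>K. f j * E (unit_vector j) e)" if "finite K" for K
    using that by induction (simp_all add: E_zero E_add E_scale)
  moreover have "E f = E (\<lambda>e. \<Sum>j\<in>J. f j * unit_vector j e)"
  proof (rule E_cong)
    fix i assume "i \<in> J"
    have "(\<Sum>j\<in>J. f j * unit_vector j i) = (\<Sum>j\<in>J. if j = i then f j else 0)"
      by (intro sum.cong) (auto simp: unit_vector_def)
    then show "f i = (\<Sum>j\<in>J. f j * unit_vector j i)"
      using \<open>i \<in> J\<close> finite_J by simp
  qed
  ultimately show ?thesis
    using finite_J by simp
qed

lemma E_measurable [measurable]: "(\<lambda>c. E c e) \<in> borel_measurable (lebesgue_prod J)"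
  by (subst E_expand) measurable

text \<open>The volume picks its basis by \<open>SOME\<close>, so existence is required; the
  extended unit vectors form one.\<close>

lemma lattice_basis_exists: "\<exists>u. lattice_basis (card J) u ext_lattice"
proof -
  define d where "d = card J"
  obtain h where h: "bij_betw h {..<d} J"
    using ex_bij_betw_nat_finite[OF finite_J] by (auto simp: d_def atLeast0LessThan)
  define u where "u i = E (unit_vector (h i))" for i
  have u_h: "(\<Sum>i<d. of_int (c i) * u i (h i')) = of_int (c i')" if "i' < d" for c and i'
  proof -
    have "(\<Sum>i<d. of_int (c i) * u i (h i')) = (\<Sum>i<d. if i = i' then of_int (c i) else 0)"
    proof (intro sum.cong refl)
      fix i assume "i \<in> {..<d}"
      then have "h i' = h i \<longleftrightarrow> i = i'"
        using h that by (auto simp: bij_betw_def inj_on_def)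
      then show "of_int (c i) * u i (h i') = (if i = i' then of_int (c i) else 0)"
        using h that bij_betwE[OF h] by (auto simp: u_def E_free unit_vector_def)
    qed
    then show ?thesis
      using that by simp
  qed
  have u_E: "(\<lambda>e. \<Sum>i<d. of_int (c i) * u i e) = E (\<lambda>e. \<Sum>i<d. of_int (c i) * unit_vector (h i) e)" for c :: "nat \<Rightarrow> int"
    by (simp add: E_sum u_def)
  have "bij_betw (\<lambda>(c :: nat \<Rightarrow> int) e. \<Sum>i<d. of_int (c i) * u i e) ({..<d} \<rightarrow>\<^sub>E UNIV) ext_lattice"
  proof (rule bij_betwI')
    fix c c' :: "nat \<Rightarrow> int" assume c: "c \<in> {..<d} \<rightarrow>\<^sub>E UNIV" "c' \<in> {..<d} \<rightarrow>\<^sub>E UNIV"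
    show "(\<lambda>e. \<Sum>i<d. of_int (c i) * u i e) = (\<lambda>e. \<Sum>i<d. of_int (c' i) * u i e) \<longleftrightarrow> c = c'"
    proof
      assume *: "(\<lambda>e. \<Sum>i<d. of_int (c i) * u i e) = (\<lambda>e. \<Sum>i<d. of_int (c' i) * u i e)"
      show "c = c'"
      proof (rule PiE_ext[OF c])
        fix i assume "i \<in> {..<d}"
        then show "c i = c' i"
          using fun_cong[OF *, of "h i"] u_h[of i] by simp
      qed
    qed simp
  next
    fix c :: "nat \<Rightarrow> int"
    show "(\<lambda>e. \<Sum>i<d. of_int (c i) * u i e) \<in> ext_lattice"
      unfolding u_E ext_lattice_def by (auto simp: unit_vector_def intro!: Ints_sum Ints_mult)
  next
    fix b assume "b \<in> ext_lattice"
    then obtain f where f: "b = E f" "\<And>j. j \<in> J \<Longrightarrow> f j \<in> \<int>"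
      by (auto simp: ext_lattice_def)
    define c where "c = (\<lambda>i\<in>{..<d}. \<lfloor>f (h i)\<rfloor>)"
    have "E (\<lambda>e. \<Sum>i<d. of_int (c i) * unit_vector (h i) e) = E f"
    proof (rule E_cong)
      fix j assume "j \<in> J"
      then obtain i where i: "i < d" "h i = j"
        using h by (auto simp: bij_betw_def)
      have "(\<Sum>i'<d. of_int (c i') * unit_vector (h i') j) = (\<Sum>i'<d. of_int (c i') * u i' (h i))"
        using i \<open>j \<in> J\<close> by (simp add: u_def E_free)
      also have "\<dots> = f j"
        using i f(2)[OF \<open>j \<in> J\<close>] u_h[OF i(1)] by (auto simp: c_def elim: Ints_cases)
      finally show "(\<Sum>i'<d. of_int (c i') * unit_vector (h i') j) = f j" .
    qed
    then show "\<exists>c\<in>{..<d} \<rightarrow>\<^sub>E UNIV. b = (\<lambda>e. \<Sum>i<d. of_int ((c :: nat \<Rightarrow> int) i) * u i e)"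
      using f by (intro bexI[of _ c]) (auto simp: u_E c_def)
  qed
  then show ?thesis
    unfolding lattice_basis_def d_def by blast
qed

text \<open>Coordinates in the basis u and entries on \<open>J\<close> both parametrise
  \<open>ext_lattice\<close> by integer points, so the change of coordinates \<open>T\<close>
  preserves measure. The base point x contributes only the translation by w restricted to
  \<open>J\<close>.\<close>

lemma relative_volume_eq:
  assumes basis: "lattice_basis d u ext_lattice"
    and x0: "\<And>j. j \<in> J \<Longrightarrow> x0 j = 0"
    and x: "x = (\<lambda>e. x0 e + E w e)"
    and P: "{c \<in> J \<rightarrow>\<^sub>E UNIV. (\<lambda>e. x0 e + E c e) \<in> P} \<in> sets (lebesgue_prod J)"
  shows "relative_volume d u x P = measure (lebesgue_prod J) {c \<in> J \<rightarrow>\<^sub>E UNIV. (\<lambda>e. x0 e + E c e) \<in> P}"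
proof -
  define comb where "comb c = (\<lambda>e. \<Sum>i<d. c i * u i e)" for c
  define T where "T c = (\<lambda>j\<in>J. comb c j)" for c
  define A where "A = {c \<in> J \<rightarrow>\<^sub>E UNIV. (\<lambda>e. x0 e + E c e) \<in> P}"
  define xJ where "xJ = (\<lambda>j\<in>J. w j)"
  have bij: "bij_betw (\<lambda>(c :: nat \<Rightarrow> int). comb (\<lambda>i. of_int (c i))) ({..<d} \<rightarrow>\<^sub>E UNIV) ext_lattice"
    using basis by (simp add: lattice_basis_def comb_def)
  \<comment> \<open>A basis in the sense of \<open>lattice_basis\<close> yields only combinations;
    the one with coefficient 1 at i and 0 elsewhere shows that \<open>u i\<close> itself is a
    lattice vector.\<close>
  have u_E: "E (u i) = u i" if "i < d" for i
  proof -
    define z :: "nat \<Rightarrow> int" where "z = (\<lambda>i'\<in>{..<d}. if i' = i then 1 else 0)"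
    have "z \<in> {..<d} \<rightarrow>\<^sub>E UNIV"
      by (simp add: z_def)
    then have "comb (\<lambda>i'. of_int (z i')) \<in> ext_lattice"
      using bij_betwE[OF bij] by blast
    also have "comb (\<lambda>i'. of_int (z i')) = u i"
    proof
      fix e
      have "comb (\<lambda>i'. of_int (z i')) e = (\<Sum>i'<d. if i' = i then u i' e else 0)"
        unfolding comb_def by (intro sum.cong) (auto simp: z_def)
      then show "comb (\<lambda>i'. of_int (z i')) e = u i e"
        using that by simp
    qed
    finally obtain f where "u i = E f"
      by (auto simp: ext_lattice_def)
    then show ?thesis
      using E_cong[of "E f" f] by (simp add: E_free)
  qed
  have comb_E: "E (comb c) = comb c" for c
    unfolding comb_def E_sum using u_E by (intro ext sum.cong) auto
  have comb_T: "comb c = E (T c)" for c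
    using E_cong[of "comb c" "T c"] by (simp add: comb_E T_def)
  have T_space: "T c \<in> space (lebesgue_prod J)" for c
    by (simp add: T_def space_PiM)
  have T_meas [measurable]: "T \<in> measurable (lebesgue_prod {..<d}) (lebesgue_prod J)"
    unfolding T_def comb_def by measurable
  have ints: "\<exists>c'\<in>{..<d} \<rightarrow>\<^sub>E (UNIV :: int set). \<forall>i<d. c i = of_int (c' i)" if "c \<in> int_points {..<d}" for c
  proof -
    have "c i = of_int \<lfloor>c i\<rfloor>" if "i < d" for i
      using \<open>c \<in> _\<close> that by (auto simp: PiE_iff elim: Ints_cases)
    then show ?thesis
      by (intro bexI[of _ "\<lambda>i\<in>{..<d}. \<lfloor>c i\<rfloor>"]) auto
  qed
  have "distr (lebesgue_prod {..<d}) (lebesgue_prod J) T = lebesgue_prod J"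
  proof (rule distr_lebesgue_prod_unimodular)
    show "T (plus_on {..<d} c c') = plus_on J (T c) (T c')" for c c'
      by (auto simp: T_def plus_on_def comb_def sum.distrib distrib_right)
  next
    fix g assume g: "g \<in> space (lebesgue_prod J)"
    \<comment> \<open>Surjectivity over the reals comes from the integers: each extended unit vector
      is an integer combination of u, and these are superposed with the real weights
      \<open>g j\<close>.\<close>
    have "\<exists>b :: nat \<Rightarrow> int. E (unit_vector j) = comb (\<lambda>i. of_int (b i))" for j
    proof -
      have "E (unit_vector j) \<in> ext_lattice"
        by (auto simp: ext_lattice_def unit_vector_def)
      then show ?thesis
        using bij_betw_imp_surj_on[OF bij] by auto
    qed
    then obtain B :: "'b \<Rightarrow> nat \<Rightarrow> int" where B: "\<And>j. E (unit_vector j) = comb (\<lambda>i. of_int (B j i))"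
      by metis
    define c where "c = (\<lambda>i\<in>{..<d}. \<Sum>j\<in>J. g j * of_int (B j i))"
    have "T c = g"
    proof
      fix j'
      show "T c j' = g j'"
      proof (cases "j' \<in> J")
        case True
        have "T c j' = (\<Sum>i<d. \<Sum>j\<in>J. g j * (of_int (B j i) * u i j'))"
          using True by (simp add: T_def comb_def c_def sum_distrib_right mult.assoc)
        also have "\<dots> = (\<Sum>j\<in>J. g j * E (unit_vector j) j')"
          unfolding B comb_def by (subst sum.swap) (simp add: sum_distrib_left)
        also have "\<dots> = (\<Sum>j\<in>J. if j = j' then g j else 0)"
          using True by (intro sum.cong) (auto simp: E_free unit_vector_def)
        finally show ?thesis
          using True finite_J by simp
      qed (use g in \<open>auto simp: T_def space_PiM PiE_iff extensional_def\<close>)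
    qed
    then show "\<exists>c\<in>space (lebesgue_prod {..<d}). T c = g"
      by (intro bexI[of _ c]) (auto simp: c_def space_PiM)
  next
    show "bij_betw T (int_points {..<d}) (int_points J)"
    proof (rule bij_betwI')
      fix c c' assume c: "c \<in> int_points {..<d}" "c' \<in> int_points {..<d}"
      show "T c = T c' \<longleftrightarrow> c = c'"
      proof
        assume "T c = T c'"
        then have "comb c = comb c'"
          by (simp add: comb_T)
        obtain z z' where z: "z \<in> {..<d} \<rightarrow>\<^sub>E (UNIV :: int set)" "\<forall>i<d. c i = of_int (z i)"
          and z': "z' \<in> {..<d} \<rightarrow>\<^sub>E (UNIV :: int set)" "\<forall>i<d. c' i = of_int (z' i)"
          using ints c by metis
        have "comb (\<lambda>i. of_int (z i)) = comb c" "comb (\<lambda>i. of_int (z' i)) = comb c'"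
          using z z' by (auto simp: comb_def)
        then have "z = z'"
          using \<open>comb c = comb c'\<close> z(1) z'(1)
          by (intro inj_onD[OF bij_betw_imp_inj_on[OF bij]]) simp_all
        show "c = c'"
          by (rule PiE_ext[OF c]) (use z z' \<open>z = z'\<close> in auto)
      qed simp
    next
      fix c assume "c \<in> int_points {..<d}"
      then obtain z where z: "z \<in> {..<d} \<rightarrow>\<^sub>E (UNIV :: int set)" "\<forall>i<d. c i = of_int (z i)"
        using ints by blast
      then have "comb c = comb (\<lambda>i. of_int (z i))"
        by (auto simp: comb_def)
      then have "comb c \<in> ext_lattice"
        using bij_betwE[OF bij] z(1) by auto
      then show "T c \<in> int_points J"
        using E_int by (auto simp: T_def ext_lattice_def)
    next
      fix g assume g: "g \<in> int_points J"
      then have "E g \<in> ext_lattice"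
        by (auto simp: ext_lattice_def PiE_iff)
      then obtain z where z: "E g = comb (\<lambda>i. of_int ((z :: nat \<Rightarrow> int) i))"
        using bij_betw_imp_surj_on[OF bij] by auto
      then have "comb (\<lambda>i\<in>{..<d}. of_int (z i)) = E g"
        by (simp add: comb_def)
      then have "T (\<lambda>i\<in>{..<d}. of_int (z i)) = (\<lambda>j\<in>J. g j)"
        by (auto simp: T_def E_free)
      also have "\<dots> = g"
        using g by (auto simp: PiE_iff extensional_def)
      finally show "\<exists>c\<in>int_points {..<d}. g = T c"
        by (intro bexI[of _ "\<lambda>i\<in>{..<d}. of_int (z i)"]) auto
    qed
  qed (use finite_J in auto)
  moreover have "{c \<in> {..<d} \<rightarrow>\<^sub>E UNIV. (\<lambda>e. x e + (\<Sum>i<d. c i * u i e)) \<in> P} =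
      T -` {g \<in> space (lebesgue_prod J). plus_on J xJ g \<in> A} \<inter> space (lebesgue_prod {..<d})"
  proof -
    have "(\<lambda>e. x e + (\<Sum>i<d. c i * u i e)) = (\<lambda>e. x0 e + E (plus_on J xJ (T c)) e)" for c
    proof -
      have "E (plus_on J xJ (T c)) = E (\<lambda>e. w e + T c e)"
        by (rule E_cong) (simp add: plus_on_def xJ_def)
      then show ?thesis
        by (simp add: E_add x flip: comb_T) (simp add: comb_def add.assoc)
    qed
    then show ?thesis
      using T_space by (auto simp: A_def space_PiM plus_on_def)
  qed
  moreover have "{g \<in> space (lebesgue_prod J). plus_on J xJ g \<in> A} \<in> sets (lebesgue_prod J)"
  proof -
    have "plus_on J xJ \<in> measurable (lebesgue_prod J) (lebesgue_prod J)"
      by (intro plus_on_measurable) (auto simp: xJ_def space_PiM)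
    then show ?thesis
      using P unfolding A_def[symmetric] by measurable
  qed
  moreover have "emeasure (lebesgue_prod J) {g \<in> space (lebesgue_prod J). plus_on J xJ g \<in> A} = emeasure (lebesgue_prod J) A"
    using P unfolding A_def[symmetric]
    by (intro emeasure_lebesgue_prod_translate finite_J) (auto simp: xJ_def space_PiM)
  ultimately have "emeasure (lebesgue_prod {..<d}) {c \<in> {..<d} \<rightarrow>\<^sub>E UNIV. (\<lambda>e. x e + (\<Sum>i<d. c i * u i e)) \<in> P} =
      emeasure (lebesgue_prod J) A"
    using emeasure_distr[OF T_meas, of "{g \<in> space (lebesgue_prod J). plus_on J xJ g \<in> A}"] by simp
  then show ?thesis
    unfolding relative_volume_def measure_def A_def by simp
qed

end

section \<open>Flows on the extended caracol graph\<close>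

lemma sum_net_flow:
  assumes "finite (arcs G)" "finite (verts G)" "tail G ` arcs G \<subseteq> verts G" "head G ` arcs G \<subseteq> verts G"
  shows "(\<Sum>v\<in>verts G. net_flow G b v) = 0"
  using sum.group[OF assms(1,2,3), of b] sum.group[OF assms(1,2,4), of b]
  by (simp add: net_flow_def sum_subtractf out_arcs_def in_arcs_def)

type_synonym arc = "(nat \<times> nat) + (nat \<times> nat)"

locale hat_caracol =
  fixes n k :: nat
  assumes n: "n \<ge> 2" and k: "k \<ge> 1"
begin

abbreviation G :: "(nat, arc) pre_digraph" where
  "G \<equiv> hat_graph (caracol n) k"

abbreviation sink_arc :: arc where
  "sink_arc \<equiv> Inr (n + 1, 0)"

definition free_source_arcs :: "(nat \<times> nat) set" where
  "free_source_arcs = {1..n + 1} \<times> {..<k} - {(n + 1, 0)}"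

definition J :: "arc set" where
  "J = Inr ` free_source_arcs \<union> (\<lambda>i. Inl (1, i)) ` {2..<n} \<union> (\<lambda>i. Inl (i, i + 1)) ` {2..<n}"

text \<open>The flows on the edges of \<open>J\<close> can be chosen freely. Those on \<open>D\<close>, one edge leaving each
  vertex except the last, are then determined by flow conservation.\<close>

definition D :: "arc set" where
  "D = {sink_arc, Inl (1, n)} \<union> (\<lambda>i. Inl (i, n + 1)) ` {2..n}"

definition from_source :: "(arc \<Rightarrow> real) \<Rightarrow> nat \<Rightarrow> real" where
  "from_source f i = (\<Sum>j<k. f (Inr (i, j)))"

text \<open>At i = n this is what vertex 1 has left after serving 2, ..., n - 1. The spine arc (1,
  2) counts as an ordinary arc leaving vertex 1.\<close>

definition from_first :: "(arc \<Rightarrow> real) \<Rightarrow> nat \<Rightarrow> real" where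
  "from_first f i = (if i = n then from_source f 1 - (\<Sum>i=2..<n. f (Inl (1, i))) else f (Inl (1, i)))"

text \<open>Flow conservation solved at vertex i. For i = 2 the spine arc from vertex 1 is already
  in \<open>from_first\<close>, hence the guard 2 < i.\<close>

definition to_sink :: "(arc \<Rightarrow> real) \<Rightarrow> nat \<Rightarrow> real" where
  "to_sink f i = from_first f i + (if 2 < i then f (Inl (i - 1, i)) else 0) + from_source f i
    - (if i < n then f (Inl (i, i + 1)) else 0)"

text \<open>A circulation: \<open>sink_arc\<close> cancels all other source flow and so may be
  negative here. The unit flow along \<open>sink_arc\<close> is added later as base point.\<close>

definition ext :: "(arc \<Rightarrow> real) \<Rightarrow> arc \<Rightarrow> real" where
  "ext f e = (if e \<in> J then f e
    else if e = sink_arc then - (\<Sum>x\<in>free_source_arcs. f (Inr x))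
    else if e = Inl (1, n) then from_first f n
    else if e \<in> D then to_sink f (fst (projl e))
    else 0)"

lemma J_disj_D: "J \<inter> D = {}"
  using n by (auto simp: J_def D_def free_source_arcs_def)

lemma ext_simps:
  "e \<in> J \<Longrightarrow> ext f e = f e"
  "ext f sink_arc = - (\<Sum>x\<in>free_source_arcs. f (Inr x))"
  "ext f (Inl (1, n)) = from_first f n"
  "2 \<le> i \<Longrightarrow> i \<le> n \<Longrightarrow> ext f (Inl (i, n + 1)) = to_sink f i"
  "e \<notin> J \<Longrightarrow> e \<notin> D \<Longrightarrow> ext f e = 0"
proof -
  have "sink_arc \<notin> J" "Inl (1, n) \<notin> J"
    using J_disj_D by (auto simp: D_def)
  then show "ext f sink_arc = - (\<Sum>x\<in>free_source_arcs. f (Inr x))" "ext f (Inl (1, n)) = from_first f n"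
    by (simp_all add: ext_def)
  show "ext f e = f e" if "e \<in> J"
    using that by (simp add: ext_def)
  show "ext f e = 0" if "e \<notin> J" "e \<notin> D"
    using that by (auto simp: ext_def D_def)
  assume i: "2 \<le> i" "i \<le> n"
  then have "Inl (i, n + 1) \<in> D"
    by (auto simp: D_def)
  moreover from this have "Inl (i, n + 1) \<notin> J"
    using J_disj_D by auto
  ultimately show "ext f (Inl (i, n + 1)) = to_sink f i"
    using i by (simp add: ext_def)
qed

text \<open>Regrouped by role: (1, 2) joins the arcs out of vertex 1 and (n, n + 1) the arcs into
  the last vertex.\<close>

lemma arcs_caracol:
  "arcs (caracol n) = (\<lambda>i. (1, i)) ` {2..n} \<union> (\<lambda>i. (i, i + 1)) ` {2..<n} \<union> (\<lambda>i. (i, n + 1)) ` {2..n}"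
proof (intro set_eqI)
  fix e :: "nat \<times> nat"
  obtain a b where e: "e = (a, b)"
    by fastforce
  show "e \<in> arcs (caracol n) \<longleftrightarrow>
      e \<in> (\<lambda>i. (1, i)) ` {2..n} \<union> (\<lambda>i. (i, i + 1)) ` {2..<n} \<union> (\<lambda>i. (i, n + 1)) ` {2..n}"
    using n unfolding e by (auto simp: caracol_def image_iff)
qed

lemma arcs_caracol_iff:
  "(a, b) \<in> arcs (caracol n) \<longleftrightarrow>
    a = 1 \<and> 2 \<le> b \<and> b \<le> n \<or> b = a + 1 \<and> 2 \<le> a \<and> a < n \<or> b = n + 1 \<and> 2 \<le> a \<and> a \<le> n"
  unfolding arcs_caracol by auto

lemma G_simps:
  "Inl (a, b) \<in> arcs G \<longleftrightarrow> (a, b) \<in> arcs (caracol n)"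
  "Inr (a, j) \<in> arcs G \<longleftrightarrow> a \<in> {1..n + 1} \<and> j < k"
  "tail G (Inl (a, b)) = a" "tail G (Inr x) = 0" "head G (Inl (a, b)) = b" "head G (Inr (a, j)) = a"
  by (auto simp: hat_graph_def caracol_def)

lemma arc_set_eqI:
  fixes A B :: "arc set"
  assumes "\<And>a b. Inl (a, b) \<in> A \<longleftrightarrow> Inl (a, b) \<in> B" "\<And>a b. Inr (a, b) \<in> A \<longleftrightarrow> Inr (a, b) \<in> B"
  shows "A = B"
proof (rule set_eqI)
  fix e :: arc
  show "e \<in> A \<longleftrightarrow> e \<in> B"
    using assms by (cases e) auto
qed

lemma arcs_G: "arcs G = J \<union> D"
proof -
  have "{2..n} = insert n {2..<n}"
    using n by auto
  moreover have "{1..n + 1} \<times> {..<k} = insert (n + 1, 0) free_source_arcs"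
    using k by (auto simp: free_source_arcs_def)
  moreover have "arcs G = Inl ` arcs (caracol n) \<union> Inr ` ({1..n + 1} \<times> {..<k})"
    by (simp add: hat_graph_def caracol_def)
  ultimately show ?thesis
    unfolding arcs_caracol J_def D_def by (simp add: image_Un image_image Un_ac insert_commute)
qed

lemma verts_G: "verts G = {0..n + 1}"
  by (auto simp: hat_graph_def caracol_def)

lemma finite_free_source_arcs: "finite free_source_arcs"
  by (simp add: free_source_arcs_def)

lemma finite_J: "finite J"
  by (simp add: J_def finite_free_source_arcs)

lemma card_J: "card J = (n + 1) * k - 1 + 2 * (n - 2)"
proof -
  have "card free_source_arcs = (n + 1) * k - 1"
    unfolding free_source_arcs_def using k by (subst card_Diff_subset) auto
  moreover have "card ((\<lambda>i. Inl (1, i) :: arc) ` {2..<n}) = n - 2"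
    by (subst card_image) (auto simp: inj_on_def)
  moreover have "card ((\<lambda>i. Inl (i, i + 1) :: arc) ` {2..<n}) = n - 2"
    by (subst card_image) (auto simp: inj_on_def)
  moreover have "card J = card (Inr ` free_source_arcs :: arc set) + card ((\<lambda>i. Inl (1, i) :: arc) ` {2..<n})
      + card ((\<lambda>i. Inl (i, i + 1) :: arc) ` {2..<n})"
    unfolding J_def by (subst card_Un_disjoint card_Un_disjoint; auto simp: finite_free_source_arcs)+
  ultimately show ?thesis
    by (simp add: card_image)
qed

lemma flow_dim_G: "flow_dim G = card J"
proof -
  have "card ((\<lambda>i. Inl (i, n + 1) :: arc) ` {2..n}) = n - 1"
    by (subst card_image) (auto simp: inj_on_def)
  then have "card D = n + 1"
    unfolding D_def using n by (subst card_Un_disjoint) auto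
  moreover have "finite D"
    by (simp add: D_def)
  ultimately have "card (arcs G) = card J + (n + 1)"
    unfolding arcs_G using J_disj_D finite_J by (simp add: card_Un_disjoint)
  then show ?thesis
    by (simp add: flow_dim_def verts_G)
qed

lemma integral_extension: "integral_extension J ext"
proof
  show "finite J"
    by (rule finite_J)
  show "ext f j = f j" if "j \<in> J" for f j
    using that by (rule ext_simps)
  show "ext f = ext g" if fg: "\<And>j. j \<in> J \<Longrightarrow> f j = g j" for f g
  proof
    fix e
    have Inr: "f (Inr x) = g (Inr x)" if "x \<in> free_source_arcs" for x
      using that by (intro fg) (simp add: J_def)
    have src: "from_source f i = from_source g i" if "1 \<le> i" "i \<le> n" for i
      unfolding from_source_def using that by (intro sum.cong refl Inr) (auto simp: free_source_arcs_def)
    have y: "f (Inl (1, i)) = g (Inl (1, i))" if "2 \<le> i" "i < n" for i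
      using that by (intro fg) (auto simp: J_def)
    have z: "f (Inl (i, i + 1)) = g (Inl (i, i + 1))" if "2 \<le> i" "i < n" for i
      using that by (intro fg) (auto simp: J_def)
    have first: "from_first f i = from_first g i" if "2 \<le> i" "i \<le> n" for i
      unfolding from_first_def using that n y src[of 1] by auto
    have sink: "to_sink f i = to_sink g i" if "2 \<le> i" "i \<le> n" for i
      unfolding to_sink_def using that first src[of i] z[of i] z[of "i - 1"] by auto
    have "(\<Sum>x\<in>free_source_arcs. f (Inr x)) = (\<Sum>x\<in>free_source_arcs. g (Inr x))"
      by (intro sum.cong refl Inr)
    then show "ext f e = ext g e"
      using fg first[of n] sink n by (auto simp: ext_def D_def)
  qed
  have from_source_add: "from_source (\<lambda>e. f e + g e) i = from_source f i + from_source g i" for f g i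
    by (simp add: from_source_def sum.distrib)
  have from_first_add: "from_first (\<lambda>e. f e + g e) i = from_first f i + from_first g i" for f g i
    by (simp add: from_first_def from_source_add sum.distrib)
  show "ext (\<lambda>e. f e + g e) = (\<lambda>e. ext f e + ext g e)" for f g
    by (rule HOL.ext) (simp add: ext_def to_sink_def from_source_add from_first_add sum.distrib)
  have from_source_scale: "from_source (\<lambda>e. t * f e) i = t * from_source f i" for f i and t :: real
    by (simp add: from_source_def sum_distrib_left)
  have from_first_scale: "from_first (\<lambda>e. t * f e) i = t * from_first f i" for f i and t :: real
    by (simp add: from_first_def from_source_scale sum_distrib_left right_diff_distrib)
  show "ext (\<lambda>e. t * f e) = (\<lambda>e. t * ext f e)" for f and t :: real
    by (rule HOL.ext) (simp add: ext_def to_sink_def from_source_scale from_first_scale sum_distrib_left algebra_simps)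
  show "ext f e \<in> \<int>" if fg: "\<And>j. j \<in> J \<Longrightarrow> f j \<in> \<int>" for f e
  proof -
    have Inr: "f (Inr x) \<in> \<int>" if "x \<in> free_source_arcs" for x
      using that by (intro fg) (simp add: J_def)
    have src: "from_source f i \<in> \<int>" if "1 \<le> i" "i \<le> n" for i
      unfolding from_source_def using that by (intro Ints_sum Inr) (auto simp: free_source_arcs_def)
    have y: "f (Inl (1, i)) \<in> \<int>" if "2 \<le> i" "i < n" for i
      using that by (intro fg) (auto simp: J_def)
    have z: "f (Inl (i, i + 1)) \<in> \<int>" if "2 \<le> i" "i < n" for i
      using that by (intro fg) (auto simp: J_def)
    have first: "from_first f i \<in> \<int>" if "2 \<le> i" "i \<le> n" for i
      unfolding from_first_def using that n y src[of 1] by auto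
    have sink: "to_sink f i \<in> \<int>" if "2 \<le> i" "i \<le> n" for i
      unfolding to_sink_def using that first src[of i] z[of i] z[of "i - 1"] by auto
    show ?thesis
      using fg first[of n] sink n Inr by (auto simp: ext_def D_def intro!: Ints_sum)
  qed
qed

sublocale ie: integral_extension J ext
  by (rule integral_extension)

lemma net_flow_source: "net_flow G b 0 = (\<Sum>x\<in>free_source_arcs. b (Inr x)) + b sink_arc"
proof -
  have "out_arcs G 0 = Inr ` insert (n + 1, 0) free_source_arcs"
    by (rule arc_set_eqI) (use k in \<open>auto simp: G_simps arcs_caracol_iff free_source_arcs_def image_iff\<close>)
  moreover have "in_arcs G 0 = {}"
    by (rule arc_set_eqI) (auto simp: G_simps arcs_caracol_iff)
  moreover have "(n + 1, 0) \<notin> free_source_arcs"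
    by (simp add: free_source_arcs_def)
  ultimately show ?thesis
    by (simp add: net_flow_def sum.reindex finite_free_source_arcs image_iff)
qed

lemma sum_source_arcs: "(\<Sum>e\<in>Inr ` ({i} \<times> {..<k}). b e) = from_source b i"
proof -
  have "Inr ` ({i} \<times> {..<k}) = (\<lambda>j. Inr (i, j) :: arc) ` {..<k}"
    by auto
  then show ?thesis
    by (simp add: sum.reindex inj_on_def from_source_def)
qed

lemma net_flow_first: "net_flow G b 1 = (\<Sum>i=2..<n. b (Inl (1, i))) + b (Inl (1, n)) - from_source b 1"
proof -
  have "out_arcs G 1 = (\<lambda>i. Inl (1, i)) ` {2..n}"
    by (rule arc_set_eqI) (auto simp: G_simps arcs_caracol_iff)
  moreover have "{2..n} = insert n {2..<n}"
    using n by auto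
  moreover have "in_arcs G 1 = Inr ` ({1} \<times> {..<k})"
    by (rule arc_set_eqI) (auto simp: G_simps arcs_caracol_iff)
  ultimately show ?thesis
    using sum_source_arcs[of b 1] by (simp add: net_flow_def sum.reindex inj_on_def image_iff)
qed

lemma net_flow_middle:
  assumes "2 \<le> i" "i \<le> n"
  shows "net_flow G b i = b (Inl (i, n + 1)) + (if i < n then b (Inl (i, i + 1)) else 0)
    - (b (Inl (1, i)) + (if 2 < i then b (Inl (i - 1, i)) else 0) + from_source b i)"
proof -
  have "out_arcs G i = insert (Inl (i, n + 1)) (if i < n then {Inl (i, i + 1)} else {})"
    by (rule arc_set_eqI) (use assms in \<open>auto simp: G_simps arcs_caracol_iff\<close>)
  then have out: "(\<Sum>e\<in>out_arcs G i. b e) = b (Inl (i, n + 1)) + (if i < n then b (Inl (i, i + 1)) else 0)"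
    by auto
  have "in_arcs G i = insert (Inl (1, i)) (if 2 < i then {Inl (i - 1, i)} else {}) \<union> Inr ` ({i} \<times> {..<k})"
    by (rule arc_set_eqI) (use assms in \<open>auto simp: G_simps arcs_caracol_iff\<close>)
  then have "(\<Sum>e\<in>in_arcs G i. b e) =
      (\<Sum>e\<in>insert (Inl (1, i)) (if 2 < i then {Inl (i - 1, i)} else {}). b e) + from_source b i"
    using sum_source_arcs[of b i] by (simp only:, subst sum.union_disjoint) auto
  then show ?thesis
    using out by (auto simp: net_flow_def)
qed

text \<open>One fixed-point equation serves twice: t = 0 describes the lattice of circulations, t =
  1 the flow space.\<close>

lemma flow_iff:
  fixes t :: real
  shows "b \<in> edge_vectors G \<and> (\<forall>v\<in>verts G. net_flow G b v = (if v = 0 then t else if v = n + 1 then - t else 0)) \<longleftrightarrow>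
    b = (\<lambda>e. t * unit_vector sink_arc e + ext b e)" (is "?L \<longleftrightarrow> ?R")
proof
  assume L: ?L
  have vanish: "b e = 0" if "e \<notin> J" "e \<notin> D" for e
    using L that by (simp add: edge_vectors_def arcs_G)
  have net: "net_flow G b 0 = t" "net_flow G b 1 = 0" "\<And>i. 2 \<le> i \<Longrightarrow> i \<le> n \<Longrightarrow> net_flow G b i = 0"
    using L n by (auto simp: verts_G)
  have first: "from_first b i = b (Inl (1, i))" if "2 \<le> i" "i \<le> n" for i
    using net(2) by (simp add: from_first_def net_flow_first[unfolded One_nat_def] )
  have sink: "to_sink b i = b (Inl (i, n + 1))" if "2 \<le> i" "i \<le> n" for i
    using net(3)[OF that] net_flow_middle[OF that, of b] first[OF that] by (simp add: to_sink_def)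
  show ?R
  proof
    fix e
    have "e = sink_arc \<or> e = Inl (1, n) \<or> (\<exists>i. 2 \<le> i \<and> i \<le> n \<and> e = Inl (i, n + 1))" if "e \<in> D"
      using that by (auto simp: D_def)
    then consider "e \<in> J" | "e = sink_arc" | "e = Inl (1, n)" | i where "2 \<le> i" "i \<le> n" "e = Inl (i, n + 1)" | "e \<notin> J" "e \<notin> D"
      by blast
    then show "b e = t * unit_vector sink_arc e + ext b e"
    proof cases
      case 1
      then have "e \<noteq> sink_arc"
        using J_disj_D by (auto simp: D_def)
      then show ?thesis
        using 1 by (simp add: unit_vector_def ext_simps)
    next
      case 2
      then show ?thesis
        using net(1) by (simp add: unit_vector_def ext_simps net_flow_source del: One_nat_def)
    next
      case 3
      then show ?thesis
        using first[of n] n by (simp add: unit_vector_def ext_simps del: One_nat_def)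
    next
      case 4
      then show ?thesis
        using sink ext_simps(4) by (simp add: unit_vector_def)
    next
      case 5
      then have "e \<noteq> sink_arc"
        by (auto simp: D_def)
      then show ?thesis
        using 5 by (simp add: unit_vector_def ext_simps vanish)
    qed
  qed
next
  assume R: ?R
  have b: "b e = t * unit_vector sink_arc e + ext b e" for e
    using R by (rule fun_cong)
  have zero: "net_flow G b 0 = t"
    using b[of sink_arc] by (simp add: net_flow_source ext_simps unit_vector_def del: One_nat_def)
  have first: "b (Inl (1, n)) = from_first b n"
    using b[of "Inl (1, n)"] by (simp add: ext_simps(3) unit_vector_def del: One_nat_def)
  then have one: "net_flow G b 1 = 0"
    by (simp add: net_flow_first from_first_def del: One_nat_def)
  have middle: "net_flow G b i = 0" if "2 \<le> i" "i \<le> n" for i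
  proof -
    have "b (Inl (i, n + 1)) = to_sink b i"
      using b[of "Inl (i, n + 1)"] ext_simps(4)[OF that] by (simp add: unit_vector_def)
    moreover have "from_first b i = b (Inl (1, i))"
      using first by (auto simp: from_first_def)
    ultimately show ?thesis
      using net_flow_middle[OF that, of b] by (simp add: to_sink_def)
  qed
  \<comment> \<open>Conservation at the last vertex is not built into \<open>ext\<close>; it follows
    because the net flows sum to zero.\<close>
  have "(\<Sum>v\<in>verts G. net_flow G b v) = 0"
  proof (rule sum_net_flow)
    show "finite (arcs G)"
      using finite_J by (simp add: arcs_G D_def)
    show "tail G ` arcs G \<subseteq> verts G" "head G ` arcs G \<subseteq> verts G"
      unfolding verts_G by (auto simp: hat_graph_def caracol_def)
  qed (simp add: verts_G)
  moreover have "verts G = insert (n + 1) (insert 0 (insert 1 {2..n}))"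
    using n by (auto simp: verts_G)
  ultimately have "net_flow G b (n + 1) = - t"
    using zero one middle n by simp
  then have "net_flow G b v = (if v = 0 then t else if v = n + 1 then - t else 0)" if "v \<in> verts G" for v
  proof -
    consider "v = 0" | "v = 1" | "2 \<le> v" "v \<le> n" | "v = n + 1"
      using \<open>v \<in> verts G\<close> unfolding verts_G atLeastAtMost_iff by linarith
    then show ?thesis
      using zero one middle \<open>net_flow G b (n + 1) = - t\<close> n by cases auto
  qed
  moreover have "b \<in> edge_vectors G"
    unfolding edge_vectors_def arcs_G
  proof (intro CollectI allI impI)
    fix e assume "e \<notin> J \<union> D"
    then show "b e = 0"
      using b[of e] by (auto simp: ext_simps(5) unit_vector_def D_def)
  qed
  ultimately show ?L
    by blast
qed

end

section \<open>The density on the cone as a product of operator weights\<close>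

lemma ennreal_exp_minus_add:
  "ennreal (exp (- (a + b))) = ennreal (exp (- a)) * ennreal (exp (- b))"
  "ennreal (exp (- a - b)) = ennreal (exp (- a)) * ennreal (exp (- b))"
  by (simp_all add: ennreal_mult[symmetric] flip: exp_add)

lemma peel_density_Free:
  "peel_density (map (Pair Free) xs @ l) \<sigma> f =
    (if \<forall>e\<in>set xs. 0 \<le> f e then ennreal (exp (- (\<Sum>e\<leftarrow>xs. f e))) else 0) * peel_density l \<sigma> f"
  by (induction xs) (auto simp: peel_weight_def peel_state_def ennreal_exp_minus_add mult.assoc)

lemma peel_density_Budget:
  "peel_density (map (Pair Budget) xs @ l) (s, p) f =
    (if \<forall>e\<in>set xs. 0 \<le> f e then ennreal (exp (- (\<Sum>e\<leftarrow>xs. f e))) else 0) *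
    peel_density l (s, p + (\<Sum>e\<leftarrow>xs. f e)) f"
  by (induction xs arbitrary: p) (auto simp: peel_weight_def peel_state_def ennreal_exp_minus_add mult.assoc add.assoc)

lemma peel_density_Inflow:
  "peel_density (map (Pair Inflow) xs @ l) (s, p) f =
    (if \<forall>e\<in>set xs. 0 \<le> f e then ennreal (exp (- (\<Sum>e\<leftarrow>xs. f e))) else 0) *
    peel_density l (s + (\<Sum>e\<leftarrow>xs. f e), p) f"
  by (induction xs arbitrary: s) (auto simp: peel_weight_def peel_state_def ennreal_exp_minus_add mult.assoc add.assoc)

text \<open>The successive bounds by the remaining budget collapse to one bound on the sum of all
  \<open>f (y l)\<close>, because these are nonnegative. The incoming spine flow is s at the first
  vertex l = i and \<open>f (z (l - 1))\<close> afterwards.\<close>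

lemma peel_density_blocks:
  fixes y z :: "nat \<Rightarrow> 'e" and x :: "nat \<Rightarrow> 'e list"
  assumes "0 \<le> p"
  shows "peel_density (concat (map (\<lambda>l. (Split, y l) # map (Pair Inflow) (x l) @ [(Pass, z l)]) [i..<n])) (s, p) f =
    (if (\<forall>l\<in>{i..<n}. 0 \<le> f (y l) \<and> (\<forall>e\<in>set (x l). 0 \<le> f e) \<and> 0 \<le> f (z l) \<and>
          f (z l) \<le> (if l = i then s else f (z (l - 1))) + f (y l) + (\<Sum>e\<leftarrow>x l. f e)) \<and>
        (\<Sum>l\<in>{i..<n}. f (y l)) \<le> p
     then ennreal (exp (- (\<Sum>l\<in>{i..<n}. \<Sum>e\<leftarrow>x l. f e))) else 0)"
  using assms
proof (induction "n - i" arbitrary: i s p)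
  case 0
  then show ?case
    by simp
next
  case (Suc m)
  then have i: "i < n" "m = n - Suc i"
    by auto
  define X where "X = (\<Sum>e\<leftarrow>x i. f e)"
  define R where "R = (\<lambda>l. \<Sum>e\<leftarrow>x l. f e)"
  have ivl: "{i..<n} = insert i {Suc i..<n}"
    using i by auto
  define A where "A \<longleftrightarrow> (\<forall>l\<in>{Suc i..<n}. 0 \<le> f (y l) \<and> (\<forall>e\<in>set (x l). 0 \<le> f e) \<and> 0 \<le> f (z l) \<and>
    f (z l) \<le> f (z (l - 1)) + f (y l) + R l)"
  define S where "S = (\<Sum>l\<in>{Suc i..<n}. f (y l))"
  have S: "0 \<le> S" if A
    using that unfolding A_def S_def by (intro sum_nonneg) auto
  have IH: "peel_density (concat (map (\<lambda>l. (Split, y l) # map (Pair Inflow) (x l) @ [(Pass, z l)]) [Suc i..<n])) (f (z i), p - f (y i)) f =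
      (if A \<and> S \<le> p - f (y i) then ennreal (exp (- (\<Sum>l\<in>{Suc i..<n}. R l))) else 0)" if "f (y i) \<le> p"
  proof -
    have "(\<forall>l\<in>{Suc i..<n}. 0 \<le> f (y l) \<and> (\<forall>e\<in>set (x l). 0 \<le> f e) \<and> 0 \<le> f (z l) \<and>
        f (z l) \<le> (if l = Suc i then f (z i) else f (z (l - 1))) + f (y l) + (\<Sum>e\<leftarrow>x l. f e)) \<longleftrightarrow> A"
      unfolding A_def R_def by (intro ball_cong) auto
    then show ?thesis
      using Suc.hyps(1)[OF i(2), of "p - f (y i)" "f (z i)"] that unfolding S_def R_def by simp
  qed
  have "peel_density (concat (map (\<lambda>l. (Split, y l) # map (Pair Inflow) (x l) @ [(Pass, z l)]) [i..<n])) (s, p) f =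
      (if 0 \<le> f (y i) \<and> f (y i) \<le> p then 1 else 0) * ((if \<forall>e\<in>set (x i). 0 \<le> f e then ennreal (exp (- X)) else 0) *
        ((if 0 \<le> f (z i) \<and> f (z i) \<le> s + f (y i) + X then 1 else 0) *
         peel_density (concat (map (\<lambda>l. (Split, y l) # map (Pair Inflow) (x l) @ [(Pass, z l)]) [Suc i..<n])) (f (z i), p - f (y i)) f))"
    using i by (simp add: upt_conv_Cons peel_density_Inflow peel_weight_def peel_state_def X_def)
  also have "\<dots> = (if ((0 \<le> f (y i) \<and> (\<forall>e\<in>set (x i). 0 \<le> f e) \<and> 0 \<le> f (z i) \<and> f (z i) \<le> s + f (y i) + X) \<and> A) \<and> f (y i) + S \<le> p
      then ennreal (exp (- (X + (\<Sum>l\<in>{Suc i..<n}. R l)))) else 0)"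
  proof (cases "f (y i) \<le> p")
    case True
    have "S \<le> p - f (y i) \<longleftrightarrow> f (y i) + S \<le> p"
      by linarith
    then show ?thesis
      unfolding IH[OF True] using True by (auto simp: ennreal_exp_minus_add)
  next
    \<comment> \<open>Both sides vanish: once \<open>f (y i)\<close> exceeds p, adding the
      nonnegative S cannot restore the bound.\<close>
    case False
    then show ?thesis
      using S by auto
  qed
  also have "(0 \<le> f (y i) \<and> (\<forall>e\<in>set (x i). 0 \<le> f e) \<and> 0 \<le> f (z i) \<and> f (z i) \<le> s + f (y i) + X) \<and> A \<longleftrightarrow>
      (\<forall>l\<in>{i..<n}. 0 \<le> f (y l) \<and> (\<forall>e\<in>set (x l). 0 \<le> f e) \<and> 0 \<le> f (z l) \<and>
        f (z l) \<le> (if l = i then s else f (z (l - 1))) + f (y l) + (\<Sum>e\<leftarrow>x l. f e))"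
    unfolding ivl A_def R_def X_def by auto
  also have "f (y i) + S = (\<Sum>l\<in>{i..<n}. f (y l))"
    by (simp add: ivl S_def)
  also have "X + (\<Sum>l\<in>{Suc i..<n}. R l) = (\<Sum>l\<in>{i..<n}. \<Sum>e\<leftarrow>x l. f e)"
    by (simp add: ivl X_def R_def)
  finally show ?case .
qed

context hat_caracol
begin

definition \<tau> :: "(arc \<Rightarrow> real) \<Rightarrow> real" where
  "\<tau> c = (\<Sum>x\<in>free_source_arcs. c (Inr x))"

definition cone :: "(arc \<Rightarrow> real) set" where
  "cone = {c \<in> space (lebesgue_prod J). \<forall>e\<in>J \<union> D - {sink_arc}. 0 \<le> ext c e}"

lemma ext_sink_arc: "ext c sink_arc = - \<tau> c"
  unfolding ext_simps(2) \<tau>_def ..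

lemma finite_D: "finite D"
  by (simp add: D_def)

lemma cone_sets: "cone \<in> sets (lebesgue_prod J)"
  unfolding cone_def using finite_J finite_D by measurable

definition source_tokens :: "nat \<Rightarrow> arc list" where
  "source_tokens i = map (\<lambda>j. Inr (i, j)) [0..<k]"

text \<open>Copy 0 of the arc into n + 1 is \<open>sink_arc\<close>, so the copies start at 1. Flow
  entering at n can only continue to n + 1, so it meets no later inequality either.\<close>

definition free_tokens :: "arc list" where
  "free_tokens = map (\<lambda>j. Inr (n + 1, j)) [1..<k] @ source_tokens n"

definition tokens :: "(peel \<times> arc) list" where
  "tokens = map (Pair Free) free_tokens @ map (Pair Budget) (source_tokens 1) @
    concat (map (\<lambda>i. (Split, Inl (1, i)) # map (Pair Inflow) (source_tokens i) @ [(Pass, Inl (i, i + 1))]) [2..<n])"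

lemma sum_source_tokens: "(\<Sum>e\<leftarrow>source_tokens i. c e) = from_source c i"
  by (simp add: source_tokens_def from_source_def comp_def interv_sum_list_conv_sum_set_nat atLeast0LessThan)

lemma sum_free_tokens: "(\<Sum>e\<leftarrow>free_tokens. c e) = (\<Sum>j\<in>{1..<k}. c (Inr (n + 1, j))) + from_source c n"
  by (simp add: free_tokens_def sum_source_tokens comp_def interv_sum_list_conv_sum_set_nat)

lemma set_source_tokens: "set (source_tokens i) = Inr ` ({i} \<times> {..<k})"
  by (auto simp: source_tokens_def)

lemma set_free_tokens: "set free_tokens = Inr ` ({n + 1} \<times> {1..<k} \<union> {n} \<times> {..<k})"
  by (auto simp: free_tokens_def set_source_tokens)

lemma free_source_arcs_eq:
  "free_source_arcs = ({n + 1} \<times> {1..<k} \<union> {n} \<times> {..<k}) \<union> ({1} \<times> {..<k} \<union> {2..<n} \<times> {..<k})"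
  using n by (auto simp: free_source_arcs_def)

lemma \<tau>_eq: "\<tau> c = (\<Sum>e\<leftarrow>free_tokens. c e) + (from_source c 1 + (\<Sum>i\<in>{2..<n}. from_source c i))"
proof -
  have "\<tau> c = (\<Sum>x\<in>{n + 1} \<times> {1..<k}. c (Inr x)) + (\<Sum>x\<in>{n} \<times> {..<k}. c (Inr x)) +
      ((\<Sum>x\<in>{1} \<times> {..<k}. c (Inr x)) + (\<Sum>x\<in>{2..<n} \<times> {..<k}. c (Inr x)))"
    unfolding \<tau>_def free_source_arcs_eq using n by (subst sum.union_disjoint; auto)+
  then show ?thesis
    by (simp only: sum_free_tokens from_source_def sum.cartesian_product') simp
qed

lemma set_tokens: "snd ` set tokens = J"
proof -
  have "snd ` set tokens = set free_tokens \<union> (set (source_tokens 1) \<union>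
      (\<Union>i\<in>{2..<n}. insert (Inl (1, i)) (insert (Inl (i, i + 1)) (set (source_tokens i)))))"
    by (simp add: tokens_def image_Un image_UN image_image)
  also have "\<dots> = J"
    unfolding J_def free_source_arcs_eq set_free_tokens set_source_tokens by auto
  finally show ?thesis .
qed

lemma map_fst_tokens:
  "map fst tokens = replicate (k - 1 + k) Free @ replicate k Budget @ concat (replicate (n - 2) (block k))"
proof -
  have "map fst (concat (map (\<lambda>i. (Split, Inl (1, i) :: arc) # map (Pair Inflow) (source_tokens i) @ [(Pass, Inl (i, i + 1))]) is)) =
      concat (replicate (length is) (block k))" for "is"
    by (induction "is") (simp_all add: source_tokens_def comp_def map_replicate_const)
  from this[of "[2..<n]"] show ?thesis
    by (simp add: tokens_def free_tokens_def source_tokens_def comp_def map_replicate_const replicate_add)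
qed

text \<open>By counting: the list is exactly as long as \<open>J\<close>, its set of arcs, is
  large.\<close>

lemma distinct_tokens: "distinct (map snd tokens)"
proof (rule card_distinct)
  have len: "length (concat (replicate m (block k))) = m * (k + 2)" for m
    by (induction m) auto
  have "length (map snd tokens) = length (map fst tokens)"
    by simp
  also have "\<dots> = (k - 1 + k) + (k + (n - 2) * (k + 2))"
    unfolding map_fst_tokens by (simp add: len)
  also have "\<dots> = card J"
  proof -
    obtain m where "n = m + 2"
      using n by (metis add.commute le_Suc_ex)
    moreover obtain k' where "k = Suc k'"
      using k by (cases k) auto
    ultimately show ?thesis
      unfolding card_J by (simp add: algebra_simps)
  qed
  also have "card J = card (set (map snd tokens))"
    using set_tokens by simp
  finally show "card (set (map snd tokens)) = length (map snd tokens)" ..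
qed

text \<open>Nonnegativity on \<open>D\<close> becomes the bounds of the peeling: the arc (1, n)
  yields the budget inequality, the arc (l, n + 1) the bound on the spine arc leaving l. The form
  \<open>l - 1 + 1\<close> matches the instance of \<open>peel_density_blocks\<close>.\<close>

lemma cone_iff:
  assumes "c \<in> space (lebesgue_prod J)"
  shows "c \<in> cone \<longleftrightarrow> (\<forall>e\<in>set free_tokens. 0 \<le> c e) \<and> (\<forall>e\<in>set (source_tokens 1). 0 \<le> c e) \<and>
    (\<forall>l\<in>{2..<n}. 0 \<le> c (Inl (1, l)) \<and> (\<forall>e\<in>set (source_tokens l). 0 \<le> c e) \<and> 0 \<le> c (Inl (l, l + 1)) \<and>
       c (Inl (l, l + 1)) \<le> (if l = 2 then 0 else c (Inl (l - 1, l - 1 + 1))) + c (Inl (1, l)) + from_source c l) \<and>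
    (\<Sum>l\<in>{2..<n}. c (Inl (1, l))) \<le> from_source c 1" (is "_ \<longleftrightarrow> ?F \<and> ?B \<and> ?V \<and> ?S")
proof -
  have J_iff: "(\<forall>e\<in>J. 0 \<le> c e) \<longleftrightarrow> ?F \<and> ?B \<and>
      (\<forall>l\<in>{2..<n}. 0 \<le> c (Inl (1, l)) \<and> (\<forall>e\<in>set (source_tokens l). 0 \<le> c e) \<and> 0 \<le> c (Inl (l, l + 1)))"
    unfolding J_def free_source_arcs_eq set_free_tokens set_source_tokens by auto
  have "c \<in> cone \<longleftrightarrow> (\<forall>e\<in>J. 0 \<le> ext c e) \<and> 0 \<le> ext c (Inl (1, n)) \<and> (\<forall>i\<in>{2..n}. 0 \<le> ext c (Inl (i, n + 1)))"
    using assms J_disj_D by (auto simp: cone_def D_def)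
  also have "\<dots> \<longleftrightarrow> (\<forall>e\<in>J. 0 \<le> c e) \<and> 0 \<le> from_first c n \<and> (\<forall>i\<in>{2..n}. 0 \<le> to_sink c i)"
    using ext_simps(1,3,4) by (metis (no_types, lifting) atLeastAtMost_iff)
  also have "\<dots> \<longleftrightarrow> (\<forall>e\<in>J. 0 \<le> c e) \<and> 0 \<le> from_first c n \<and> (\<forall>i\<in>{2..<n}. 0 \<le> to_sink c i)"
  proof -
    \<comment> \<open>No spine arc between inner vertices leaves n, so nothing is subtracted and the
      flow to the last vertex is a sum of nonnegative terms.\<close>
    have "0 \<le> to_sink c n" if c: "\<forall>e\<in>J. 0 \<le> c e" and first: "0 \<le> from_first c n"
    proof -
      have "0 \<le> c (Inl (n - 1, n))" if "2 < n"
      proof -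
        have "(Inl (n - 1, n) :: arc) = Inl (n - 1, n - 1 + 1)"
          using that by simp
        also have "\<dots> \<in> J"
          unfolding J_def using that by auto
        finally show ?thesis
          using c by blast
      qed
      moreover have "0 \<le> from_source c n"
        unfolding from_source_def using c n by (intro sum_nonneg) (auto simp: J_def free_source_arcs_def)
      ultimately show ?thesis
        using first by (simp add: to_sink_def)
    qed
    moreover have "{2..n} = insert n {2..<n}"
      using n by auto
    ultimately show ?thesis
      by auto
  qed
  also have "0 \<le> from_first c n \<longleftrightarrow> ?S"
    by (simp add: from_first_def)
  also have "(\<forall>i\<in>{2..<n}. 0 \<le> to_sink c i) \<longleftrightarrow> (\<forall>l\<in>{2..<n}.
      c (Inl (l, l + 1)) \<le> (if l = 2 then 0 else c (Inl (l - 1, l - 1 + 1))) + c (Inl (1, l)) + from_source c l)"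
    by (intro ball_cong) (auto simp: to_sink_def from_first_def)
  finally show ?thesis
    unfolding J_iff by blast
qed

lemma peel_density_tokens:
  assumes "c \<in> space (lebesgue_prod J)"
  shows "peel_density tokens (0, 0) c = indicator cone c * ennreal (exp (- \<tau> c))"
proof (cases "(\<forall>e\<in>set free_tokens. 0 \<le> c e) \<and> (\<forall>e\<in>set (source_tokens 1). 0 \<le> c e)")
  case True
  then have "0 \<le> from_source c 1"
    unfolding from_source_def by (intro sum_nonneg) (auto simp: set_source_tokens)
  note blocks = peel_density_blocks[OF this, of "\<lambda>i. Inl (1, i)" source_tokens "\<lambda>i. Inl (i, i + 1)" 2 n 0 c]
  have "peel_density tokens (0, 0) c = ennreal (exp (- (\<Sum>e\<leftarrow>free_tokens. c e))) * (ennreal (exp (- from_source c 1)) *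
      (if c \<in> cone then ennreal (exp (- (\<Sum>l\<in>{2..<n}. from_source c l))) else 0))"
    unfolding tokens_def peel_density_Free peel_density_Budget sum_source_tokens add_0 blocks cone_iff[OF assms]
    using True by (simp add: sum_source_tokens)
  then show ?thesis
    unfolding \<tau>_eq ennreal_exp_minus_add by (auto simp: indicator_def)
next
  case False
  then have "c \<notin> cone"
    using cone_iff[OF assms] by blast
  then show ?thesis
    using False by (auto simp: tokens_def peel_density_Free peel_density_Budget)
qed

text \<open>There are r = n - 2 blocks, one for each of the vertices 2, ..., n - 1.\<close>

lemma nn_integral_cone:
  "(\<integral>\<^sup>+c. indicator cone c * ennreal (exp (- \<tau> c)) \<partial>lebesgue_prod J) =
    ennreal (real ((n + k - 3) choose (k - 1)) * real ((k * n + 2 * n - 5) choose (n - 2)) / real (n - 1))"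
proof -
  have "(\<integral>\<^sup>+c. indicator cone c * ennreal (exp (- \<tau> c)) \<partial>lebesgue_prod J) =
      (\<integral>\<^sup>+c. peel_density tokens (0, 0) c \<partial>lebesgue_prod (snd ` set tokens))"
    unfolding set_tokens by (rule nn_integral_cong) (simp add: peel_density_tokens)
  also have "\<dots> = foldr transfer (map fst tokens) (\<lambda>_. 1) (0, 0)"
    by (rule nn_integral_peel_density[OF distinct_tokens])
  also have "\<dots> = ennreal (real ((n - 2 + k - 1) choose (k - 1)) *
      real ((k * (n - 2 + 2) + 2 * (n - 2) - 1) choose (n - 2)) / real (Suc (n - 2)))"
    unfolding map_fst_tokens by (rule transfer_caracol[OF k])
  also have "n - 2 + k - 1 = n + k - 3"
    using n k by simp
  also have "n - 2 + 2 = n"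
    using n by simp
  also have "k * n + 2 * (n - 2) - 1 = k * n + 2 * n - 5"
    using n by simp
  also have "Suc (n - 2) = n - 1"
    using n by simp
  finally show ?thesis .
qed

lemma emeasure_truncated_cone:
  "ennreal (fact (card J)) * emeasure (lebesgue_prod J) {c \<in> cone. \<tau> c \<le> 1} =
    ennreal (real ((n + k - 3) choose (k - 1)) * real ((k * n + 2 * n - 5) choose (n - 2)) / real (n - 1))"
proof -
  have "(\<integral>\<^sup>+c. indicator cone c * ennreal (exp (- \<tau> c)) \<partial>lebesgue_prod J) =
      ennreal (fact (card J)) * emeasure (lebesgue_prod J) {c \<in> cone. \<tau> c \<le> 1}"
  proof (rule emeasure_cone[OF finite_J cone_sets])
    have \<tau>_ext: "\<tau> c = - ext c sink_arc" for c
      using ext_sink_arc[of c] by simp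
    then show "\<tau> \<in> borel_measurable (lebesgue_prod J)"
      by (simp add: fun_eq_iff cong: measurable_cong)
    show "0 \<le> \<tau> c" if "c \<in> cone" for c
      unfolding \<tau>_def
    proof (rule sum_nonneg)
      fix x assume "x \<in> free_source_arcs"
      then have "Inr x \<in> J" "Inr x \<noteq> sink_arc"
        by (auto simp: J_def free_source_arcs_def)
      moreover from this have "0 \<le> ext c (Inr x)"
        using that unfolding cone_def by blast
      ultimately show "0 \<le> c (Inr x)"
        by (simp add: ext_simps(1))
    qed
    have scale: "ext (\<lambda>i\<in>J. c i / t) e = ext c e / t" for c e and t :: real
    proof -
      have "ext (\<lambda>i\<in>J. c i / t) = ext (\<lambda>e. (1 / t) * c e)"
        by (rule ie.E_cong) simp
      then show ?thesis
        unfolding ie.E_scale by simp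
    qed
    show "(\<lambda>i\<in>J. c i / t) \<in> cone \<longleftrightarrow> c \<in> cone" if "c \<in> space (lebesgue_prod J)" "0 < t" for c t
      using that by (auto simp: cone_def scale space_PiM zero_le_divide_iff)
    show "\<tau> (\<lambda>i\<in>J. c i / t) = \<tau> c / t" for c t
      by (simp add: \<tau>_ext scale)
  qed
  then show ?thesis
    by (simp add: nn_integral_cone)
qed

section \<open>Lattice, flow space and polytope in the free coordinates\<close>

abbreviation source_flow :: "nat \<Rightarrow> int" where
  "source_flow \<equiv> \<lambda>v. if v = 0 then 1 else 0"

text \<open>Circulations are the fixed points of \<open>ext\<close>, and \<open>ext b\<close>
  depends only on the entries of b on \<open>J\<close>.\<close>

lemma flow_lattice_eq: "flow_lattice G = ie.ext_lattice"
proof -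
  have flow: "b \<in> edge_vectors G \<and> (\<forall>v\<in>verts G. net_flow G b v = 0) \<longleftrightarrow> b = ext b" for b
  proof -
    have "(if v = 0 then 0 else if v = n + 1 then - 0 else 0) = (0 :: real)" for v
      by simp
    then show ?thesis
      using flow_iff[of b 0] by (simp only: mult_zero_left add_0)
  qed
  show ?thesis
  proof (intro equalityI subsetI)
    fix b assume "b \<in> flow_lattice G"
    then have "b = ext b" "\<forall>e. b e \<in> \<int>"
      using flow[of b] by (auto simp: flow_lattice_def)
    then show "b \<in> ie.ext_lattice"
      unfolding ie.ext_lattice_def by blast
  next
    fix b assume "b \<in> ie.ext_lattice"
    then obtain f where f: "b = ext f" "\<forall>j\<in>J. f j \<in> \<int>"
      by (auto simp: ie.ext_lattice_def)
    then have "ext b = ext f"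
      by (intro ie.E_cong) (simp add: ext_simps)
    then show "b \<in> flow_lattice G"
      using flow[of b] f ie.E_int[of f] by (auto simp: flow_lattice_def)
  qed
qed

lemma flow_space_iff: "b \<in> flow_space G source_flow \<longleftrightarrow> b = (\<lambda>e. unit_vector sink_arc e + ext b e)"
proof -
  have "Max (verts G) = n + 1"
    unfolding verts_G by (rule Max_eqI) auto
  moreover have "(\<Sum>w\<in>{0..n + 1} - {n + 1}. source_flow w) = 1"
    by (subst sum.delta) auto
  ultimately have "full_net_flow G source_flow v = (if v = 0 then 1 else if v = n + 1 then - 1 else 0)" for v
    by (simp add: full_net_flow_def verts_G)
  then have "real_of_int (full_net_flow G source_flow v) = (if v = 0 then 1 else if v = n + 1 then - 1 else 0)" for v
    by simp
  then show ?thesis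
    using flow_iff[of b 1] by (simp add: flow_space_def)
qed

text \<open>The base point is nonzero on \<open>sink_arc\<close> only. There nonnegativity reads
  \<tau> \<le> 1; on every other arc it is homogeneous and belongs to the cone.\<close>

lemma flow_polytope_coordinates:
  "{c \<in> J \<rightarrow>\<^sub>E UNIV. (\<lambda>e. unit_vector sink_arc e + ext c e) \<in> flow_polytope G source_flow} = {c \<in> cone. \<tau> c \<le> 1}"
proof (intro set_eqI)
  fix c
  define b where "b = (\<lambda>e. unit_vector sink_arc e + ext c e)"
  have sink: "sink_arc \<notin> J" "sink_arc \<in> D"
    using J_disj_D by (auto simp: D_def)
  have "ext b = ext c"
    using sink by (intro ie.E_cong) (auto simp: b_def unit_vector_def ext_simps)
  then have "b \<in> flow_space G source_flow"
    by (simp add: flow_space_iff b_def)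
  then have "b \<in> flow_polytope G source_flow \<longleftrightarrow> (\<forall>e\<in>J \<union> D. 0 \<le> b e)"
    by (simp add: flow_polytope_def arcs_G)
  also have "\<dots> \<longleftrightarrow> (\<forall>e\<in>J \<union> D - {sink_arc}. 0 \<le> b e) \<and> 0 \<le> b sink_arc"
    using sink by blast
  also have "\<dots> \<longleftrightarrow> (\<forall>e\<in>J \<union> D - {sink_arc}. 0 \<le> ext c e) \<and> \<tau> c \<le> 1"
    using ext_sink_arc[of c] by (auto simp: b_def unit_vector_def)
  finally show "c \<in> {c \<in> J \<rightarrow>\<^sub>E UNIV. (\<lambda>e. unit_vector sink_arc e + ext c e) \<in> flow_polytope G source_flow} \<longleftrightarrow>
      c \<in> {c \<in> cone. \<tau> c \<le> 1}"
    unfolding b_def by (simp add: cone_def space_PiM)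
qed

lemma E_poly_eq:
  "E_poly (caracol n) k =
    real ((n + k - 3) choose (k - 1)) * real ((k * n + 2 * n - 5) choose (n - 2)) / real (n - 1)" (is "_ = ?V")
proof -
  define u where "u = (SOME u. lattice_basis (flow_dim G) u (flow_lattice G))"
  define x where "x = (SOME x. x \<in> flow_space G source_flow)"
  have u: "lattice_basis (card J) u ie.ext_lattice"
    unfolding u_def flow_dim_G flow_lattice_eq by (rule someI_ex[OF ie.lattice_basis_exists])
  have sink: "sink_arc \<notin> J"
    using J_disj_D by (auto simp: D_def)
  then have zero: "unit_vector sink_arc j = 0" if "j \<in> J" for j
    using that by (auto simp: unit_vector_def)
  \<comment> \<open>The unit flow along \<open>sink_arc\<close> witnesses that the flow space is
    nonempty, so the base point picked by \<open>SOME\<close> really lies in it.\<close>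
  have "ext (unit_vector sink_arc) = ext (\<lambda>_. 0)"
    by (rule ie.E_cong) (rule zero)
  then have "unit_vector sink_arc \<in> flow_space G source_flow"
    unfolding flow_space_iff by (simp add: ie.E_zero)
  then have "x \<in> flow_space G source_flow"
    unfolding x_def by (rule someI[where P = "\<lambda>x. x \<in> flow_space G source_flow"])
  then have x: "x = (\<lambda>e. unit_vector sink_arc e + ext x e)"
    by (simp add: flow_space_iff)
  have "{c \<in> cone. \<tau> c \<le> 1} = {c \<in> space (lebesgue_prod J). c \<in> cone \<and> - ext c sink_arc \<le> 1}"
    unfolding ext_sink_arc by (auto simp: cone_def)
  also have "\<dots> \<in> sets (lebesgue_prod J)"
    using cone_sets by measurable
  finally have meas: "{c \<in> cone. \<tau> c \<le> 1} \<in> sets (lebesgue_prod J)" .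
  have "E_poly (caracol n) k = fact (card J) * relative_volume (card J) u x (flow_polytope G source_flow)"
    by (simp add: E_poly_def flow_polytope_vol_def flow_dim_G u_def x_def)
  also have "\<dots> = fact (card J) * measure (lebesgue_prod J) {c \<in> cone. \<tau> c \<le> 1}"
    using ie.relative_volume_eq[OF u zero x, of "flow_polytope G source_flow"] meas
    unfolding flow_polytope_coordinates by simp
  also have "\<dots> = enn2real (ennreal (fact (card J)) * emeasure (lebesgue_prod J) {c \<in> cone. \<tau> c \<le> 1})"
    by (simp add: enn2real_mult measure_def)
  also have "\<dots> = ?V"
    unfolding emeasure_truncated_cone by simp
  finally show ?thesis .
qed

end

lemma divide_swap:
  fixes a q x y :: real
  shows "a * x = q * y \<Longrightarrow> a \<noteq> 0 \<Longrightarrow> q \<noteq> 0 \<Longrightarrow> y / a = 1 / q * x"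
  by (simp add: field_simps)

theorem theorem1p2:
  fixes n k :: nat
  assumes "n \<ge> 2" and "k \<ge> 1"
  shows "E_poly (caracol n) k =
    1 / real (k * n + n - 3) * real ((k * n + 2 * n - 5) choose (n - 1)) * real ((n + k - 3) choose (k - 1))"
proof -
  interpret hat_caracol n k
    using assms by unfold_locales
  define N where "N = k * n + 2 * n - 5"
  \<comment> \<open>Together with n \<ge> 2 this keeps the natural subtractions from truncating.
    Absorption of binomials then trades the denominator n - 1 for N - (n - 2) = k n + n - 3.\<close>
  have "n \<le> k * n"
    using assms by simp
  then have N: "N = (n - 2) + (k * n + n - 3)" "0 < k * n + n - 3" "Suc (n - 2) = n - 1"
    unfolding N_def using assms(1) by linarith+
  have "Suc (n - 2) * (N choose Suc (n - 2)) = (N - (n - 2)) * (N choose (n - 2))"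
    unfolding binomial_absorption binomial_absorb_comp ..
  then have "(n - 1) * (N choose (n - 1)) = (k * n + n - 3) * (N choose (n - 2))"
    using N by simp
  then have "real (n - 1) * real (N choose (n - 1)) = real (k * n + n - 3) * real (N choose (n - 2))"
    by (metis of_nat_mult)
  then have eq: "real (N choose (n - 2)) / real (n - 1) = 1 / real (k * n + n - 3) * real (N choose (n - 1))"
    using N by (intro divide_swap) auto
  show ?thesis
    unfolding E_poly_eq N_def[symmetric] eq[symmetric] by simp
qed

end
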